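(* Let $r,s\in\mathbb{R}$ with $0<r$, $0<s$, $r+s<1$, let $a,b\in\mathbb{R}$ be such that the three intervals $[0,r]$, $[a,a+s]$, $[b,b+1-r-s]$ are pairwise disjoint, and let $\Omega=[0,r]\cup[a,a+s]\cup[b,b+1-r-s]$. Suppose $(\Omega,\Lambda)$ is a spectral pair with $0\in\Lambda$, and let $d$ be the smallest positive integer such that $d\mathbb{Z}\subseteq\Lambda$ (such an integer exists, because the spectrum of a spectral set that is a finite union of intervals is periodic). Suppose that it is not the case that both $\dim V_\Omega(d\mathbb{Z})=1$ and $\dim V_\Omega(\Lambda\setminus d\mathbb{Z})=3$. Then $\Omega$ tiles $\mathbb{R}$ by translations.
   Context: A Lebesgue measurable set $\Omega\subset\mathbb{R}$ of finite positive measure is a spectral set with spectrum $\Lambda\subset\mathbb{R}$, and $(\Omega,\Lambda)$ is called a spectral pair, if the functions $e_\lambda(x)=|\Omega|^{-1/2}e^{2\pi i\lambda x}\chi_\Omega(x)$, $\lambda\in\Lambda$, form an orthonormal basis of $L^2(\Omega)$. The set $\Omega$ tiles $\mathbb{R}$ by translations if there is a set $\mathcal{T}\subset\mathbb{R}$ such that $\{\Omega+t: t\in\mathcal{T}\}$ is a partition of $\mathbb{R}$ up to Lebesgue null sets. For $\Omega=[0,r]\cup[a,a+s]\cup[b,b+1-r-s]$ define $\varphi_\Omega:\mathbb{R}\to\mathbb{C}^3\times\mathbb{C}^3$ by $$\varphi_\Omega(x)=\left(e^{2\pi i x r},\,e^{2\pi i x(a+s)},\,e^{2\pi i x(b+1-r-s)};\;1,\,e^{2\pi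 i x a},\,e^{2\pi i x b}\right).$$ For a subset $S\subseteq\mathbb{R}$, $V_\Omega(S)$ denotes the complex linear subspace of $\mathbb{C}^3\times\mathbb{C}^3$ spanned by $\{\varphi_\Omega(x): x\in S\}$, and $\dim$ is its complex dimension. *)

theory Defs
  imports "HOL-Analysis.Analysis"
begin

text \<open>Elements of \<open>L\<^sup>2(M)\<close> are represented by functions rather than by classes modulo null sets.\<close>

definition L2_space :: "'a measure \<Rightarrow> ('a \<Rightarrow> complex) set" where
  "L2_space M = {f. f \<in> borel_measurable M \<and> integrable M (\<lambda>x. (norm (f x))\<^sup>2)}"

definition L2_inner :: "'a measure \<Rightarrow> ('a \<Rightarrow> complex) \<Rightarrow> ('a \<Rightarrow> complex) \<Rightarrow> complex" where
  "L2_inner M f g = (LINT x|M. f x * cnj (g x))"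

definition L2_norm :: "'a measure \<Rightarrow> ('a \<Rightarrow> complex) \<Rightarrow> real" where
  "L2_norm M f = sqrt (LINT x|M. (norm (f x))\<^sup>2)"

definition orthonormal_basis_L2 :: "'a measure \<Rightarrow> 'i set \<Rightarrow> ('i \<Rightarrow> 'a \<Rightarrow> complex) \<Rightarrow> bool" where
  "orthonormal_basis_L2 M I e \<longleftrightarrow>
     (\<forall>i\<in>I. e i \<in> L2_space M) \<and>
     (\<forall>i\<in>I. \<forall>j\<in>I. L2_inner M (e i) (e j) = (if i = j then 1 else 0)) \<and>
     (\<forall>f\<in>L2_space M. \<forall>\<epsilon>>0. \<exists>F c. finite F \<and> F \<subseteq> I \<and>
        L2_norm M (\<lambda>x. f x - (\<Sum>i\<in>F. c i * e i x)) < \<epsilon>)"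

definition spec_exp :: "real set \<Rightarrow> real \<Rightarrow> real \<Rightarrow> complex" where
  "spec_exp \<Omega> l x =
     complex_of_real (measure lebesgue \<Omega> powr (- 1 / 2)) *
     exp (2 * of_real pi * \<i> * of_real l * of_real x) * indicator \<Omega> x"

definition spectral_pair :: "real set \<Rightarrow> real set \<Rightarrow> bool" where
  "spectral_pair \<Omega> \<Lambda> \<longleftrightarrow>
     \<Omega> \<in> lmeasurable \<and> measure lebesgue \<Omega> > 0 \<and>
     orthonormal_basis_L2 (lebesgue_on \<Omega>) \<Lambda> (spec_exp \<Omega>)"

definition tiles_by_translations :: "real set \<Rightarrow> bool" where
  "tiles_by_translations \<Omega> \<longleftrightarrow>
     (\<exists>T. - (\<Union>t\<in>T. (\<lambda>x. x + t) ` \<Omega>) \<in> null_sets lebesgue \<and>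
          (\<forall>t\<in>T. \<forall>u\<in>T. t \<noteq> u \<longrightarrow>
             (\<lambda>x. x + t) ` \<Omega> \<inter> (\<lambda>x. x + u) ` \<Omega> \<in> null_sets lebesgue))"

definition three_intervals :: "real \<Rightarrow> real \<Rightarrow> real \<Rightarrow> real \<Rightarrow> real set" where
  "three_intervals r s a b = {0..r} \<union> {a..a + s} \<union> {b..b + 1 - r - s}"

text \<open>\<open>\<complex>\<^sup>3 \<times> \<complex>\<^sup>3\<close> as a vector space over \<open>\<complex>\<close>: the unqualified \<open>span\<close> and \<open>dim\<close> are the real ones.\<close>

global_interpretation c33: finite_dimensional_vector_space_prod
  "(*s) :: complex \<Rightarrow> complex^3 \<Rightarrow> complex^3" "(*s) :: complex \<Rightarrow> complex^3 \<Rightarrow> complex^3"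
  cart_basis cart_basis
  ..

definition phi :: "real \<Rightarrow> real \<Rightarrow> real \<Rightarrow> real \<Rightarrow> real \<Rightarrow> (complex^3) \<times> (complex^3)" where
  "phi r s a b x =
     (let E = (\<lambda>y. exp (2 * of_real pi * \<i> * of_real (x * y))) in
      (vector [E r, E (a + s), E (b + 1 - r - s)], vector [1, E a, E b]))"

definition V_space ::
    "real \<Rightarrow> real \<Rightarrow> real \<Rightarrow> real \<Rightarrow> real set \<Rightarrow> ((complex^3) \<times> (complex^3)) set" where
  "V_space r s a b S = c33.p.span (phi r s a b ` S)"

definition int_multiples :: "nat \<Rightarrow> real set" where
  "int_multiples d = range (\<lambda>k::int. real d * of_int k)"

end

theory Submission
  imports Defs "HOL-Computational_Algebra.Polynomial"
begin

text \<open>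
  Orthogonality says that the signed endpoint sums of \<open>e(x - y)\<close> vanish for all \<open>x, y \<in> \<Lambda>\<close>, and completeness
  says that \<open>\<Lambda>\<close> is maximal with this property. Multiplying by \<open>e(d k)\<close> and interpolating splits each
  signed sum according to the classes of the endpoints modulo \<open>1/d\<close>. If the endpoints are not all in
  one class, comparing few unit complex numbers shows that \<open>\<Lambda>\<close> consists of one or two cosets of a
  lattice. If they all lie in \<open>\<int>/d\<close>, the dimension hypothesis leaves \<open>dim V(\<Lambda> - d \<int>) \<le> 2\<close>; an affine map
  of \<open>\<complex>\<close> that keeps three points of the unit circle on the circle is linear or constant, so \<open>\<Lambda>\<close> has at
  most three cosets, or else it is \<open>d \<int>\<close> together with a coset of a larger lattice, which a count of
  cosets against the measure of \<open>\<Omega>\<close> excludes.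

  A spectrum made of \<open>p \<le> 3\<close> cosets of \<open>g \<int>\<close> makes almost every fibre \<open>{n. y + n/g \<in> \<Omega>}\<close> a set of \<open>p\<close>
  integers on which a character sums to zero. Since \<open>p \<le> 3\<close>, its values there are the \<open>p\<close>-th roots of unity up to
  rotation, so one set of integers is a tiling complement of all fibres simultaneously.
\<close>

section \<open>Preliminaries\<close>

lemma borel_measurable_cnj [measurable]: "cnj \<in> borel_measurable borel"
  by (intro borel_measurable_continuous_onI continuous_on_cnj continuous_on_id)

lemma L2_space_add:
  assumes "f \<in> L2_space M" "g \<in> L2_space M"
  shows "(\<lambda>x. f x + g x) \<in> L2_space M"
proof -
  have [measurable]: "f \<in> borel_measurable M" "g \<in> borel_measurable M"
    using assms by (auto simp: L2_space_def)
  have bound: "(norm (f x + g x))\<^sup>2 \<le> 2 * (norm (f x))\<^sup>2 + 2 * (norm (g x))\<^sup>2" for x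
  proof -
    have "(norm (f x + g x))\<^sup>2 \<le> (norm (f x) + norm (g x))\<^sup>2"
      by (intro power_mono norm_triangle_ineq) auto
    also have "\<dots> \<le> 2 * (norm (f x))\<^sup>2 + 2 * (norm (g x))\<^sup>2"
      using sum_squares_bound[of "norm (f x)" "norm (g x)"] by (simp add: power2_sum)
    finally show ?thesis .
  qed
  have "integrable M (\<lambda>x. 2 * (norm (f x))\<^sup>2 + 2 * (norm (g x))\<^sup>2)"
    using assms by (auto simp: L2_space_def)
  then have "integrable M (\<lambda>x. (norm (f x + g x))\<^sup>2)"
    by (rule Bochner_Integration.integrable_bound) (use bound in auto)
  then show ?thesis by (simp add: L2_space_def)
qed

lemma L2_space_cmult:
  assumes "f \<in> L2_space M"
  shows "(\<lambda>x. c * f x) \<in> L2_space M"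
  using assms by (auto simp: L2_space_def norm_mult power_mult_distrib)

lemma L2_space_sum:
  assumes "\<And>i. i \<in> F \<Longrightarrow> f i \<in> L2_space M"
  shows "(\<lambda>x. \<Sum>i\<in>F. f i x) \<in> L2_space M"
proof (cases "finite F")
  case True
  then show ?thesis using assms
  proof (induction F rule: finite_induct)
    case empty
    then show ?case by (simp add: L2_space_def)
  next
    case (insert i F)
    then have "(\<lambda>x. f i x + (\<Sum>i\<in>F. f i x)) \<in> L2_space M"
      by (intro L2_space_add) auto
    then show ?case using insert by simp
  qed
qed (simp add: L2_space_def)

lemma L2_space_integrable_mult:
  assumes "f \<in> L2_space M" "g \<in> L2_space M"
  shows "integrable M (\<lambda>x. f x * cnj (g x))"
proof -
  have [measurable]: "f \<in> borel_measurable M" "g \<in> borel_measurable M"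
    using assms by (auto simp: L2_space_def)
  have "integrable M (\<lambda>x. (norm (f x))\<^sup>2 + (norm (g x))\<^sup>2)"
    using assms by (auto simp: L2_space_def)
  then show ?thesis
  proof (rule Bochner_Integration.integrable_bound)
    show "AE x in M. norm (f x * cnj (g x)) \<le> norm ((norm (f x))\<^sup>2 + (norm (g x))\<^sup>2)"
    proof (intro AE_I2)
      fix x
      have "2 * (norm (f x) * norm (g x)) \<le> (norm (f x))\<^sup>2 + (norm (g x))\<^sup>2"
        using sum_squares_bound[of "norm (f x)" "norm (g x)"] by simp
      moreover have "0 \<le> norm (f x) * norm (g x)" by simp
      ultimately have "norm (f x) * norm (g x) \<le> (norm (f x))\<^sup>2 + (norm (g x))\<^sup>2"
        by linarith
      then show "norm (f x * cnj (g x)) \<le> norm ((norm (f x))\<^sup>2 + (norm (g x))\<^sup>2)"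
        by (simp add: norm_mult)
    qed
  qed measurable
qed

text \<open>Every finite combination of the basis is orthogonal to \<open>f\<close>, so by
  Pythagoras it is at least as far from \<open>f\<close> as 0 is. The density clause would bring
  some combination closer than that unless \<open>f\<close> has norm 0.\<close>

lemma orthonormal_basis_L2_orthogonal_zero:
  assumes basis: "orthonormal_basis_L2 M I e" and f: "f \<in> L2_space M"
    and orth: "\<And>i. i \<in> I \<Longrightarrow> L2_inner M f (e i) = 0"
  shows "(LINT x|M. (norm (f x))\<^sup>2) = 0"
proof (rule ccontr)
  define N where "N = (LINT x|M. (norm (f x))\<^sup>2)"
  assume "(LINT x|M. (norm (f x))\<^sup>2) \<noteq> 0"
  moreover have "0 \<le> N" unfolding N_def by simp
  ultimately have N: "N > 0" unfolding N_def by linarith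
  then obtain F c where F: "finite F" "F \<subseteq> I"
    and less: "L2_norm M (\<lambda>x. f x - (\<Sum>i\<in>F. c i * e i x)) < sqrt N"
    using basis f unfolding orthonormal_basis_L2_def by (meson real_sqrt_gt_zero)
  define g where "g x = (\<Sum>i\<in>F. c i * e i x)" for x
  have e: "e i \<in> L2_space M" if "i \<in> F" for i
    using basis F that unfolding orthonormal_basis_L2_def by auto
  have g: "g \<in> L2_space M"
    unfolding g_def by (intro L2_space_sum L2_space_cmult e)
  have "(LINT x|M. f x * cnj (g x)) = (LINT x|M. (\<Sum>i\<in>F. cnj (c i) * (f x * cnj (e i x))))"
    by (simp add: g_def sum_distrib_left mult_ac)
  also have "\<dots> = (\<Sum>i\<in>F. cnj (c i) * L2_inner M f (e i))"
    unfolding L2_inner_def using L2_space_integrable_mult[OF f e]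
    by (subst Bochner_Integration.integral_sum) auto
  also have "\<dots> = 0"
    using orth F by (intro sum.neutral) auto
  finally have fg0: "(LINT x|M. f x * cnj (g x)) = 0" .
  have "(LINT x|M. Re (f x * cnj (g x))) = Re (LINT x|M. f x * cnj (g x))"
    by (rule integral_Re[OF L2_space_integrable_mult[OF f g]])
  then have fg: "(LINT x|M. Re (f x * cnj (g x))) = 0"
    using fg0 by simp
  have int: "integrable M (\<lambda>x. Re (f x * cnj (g x)))"
    by (rule integrable_Re[OF L2_space_integrable_mult[OF f g]])
  have "(LINT x|M. (norm (f x - g x))\<^sup>2)
      = (LINT x|M. (norm (f x))\<^sup>2 + (norm (g x))\<^sup>2 - 2 * Re (f x * cnj (g x)))"
    by (intro Bochner_Integration.integral_cong)
      (auto simp only: cmod_power2, auto simp: power2_eq_square algebra_simps)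
  also have "\<dots> = N + (LINT x|M. (norm (g x))\<^sup>2) - 2 * (LINT x|M. Re (f x * cnj (g x)))"
    using f g int unfolding N_def L2_space_def by (simp del: times_complex.sel)
  also have "\<dots> \<ge> N"
    using fg by simp
  finally have "N \<le> (LINT x|M. (norm (f x - g x))\<^sup>2)" .
  moreover have "(LINT x|M. (norm (f x - g x))\<^sup>2) < N"
    using less by (simp add: L2_norm_def g_def)
  ultimately show False by simp
qed

section \<open>The character exp(2 pi i t)\<close>

definition ee :: "real \<Rightarrow> complex" where
  "ee t = cis (2 * pi * t)"

lemma ee_0 [simp]: "ee 0 = 1"
  by (simp add: ee_def)

lemma ee_neq_0 [simp]: "ee t \<noteq> 0"
  by (simp add: ee_def)

lemma norm_ee [simp]: "norm (ee t) = 1"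
  by (simp add: ee_def)

lemma ee_add: "ee (s + t) = ee s * ee t"
  by (simp add: ee_def cis_mult distrib_left)

lemma cnj_ee: "cnj (ee t) = ee (- t)"
  by (simp add: ee_def cis_cnj)

lemma ee_diff: "ee (s - t) = ee s / ee t"
  by (simp add: ee_def cis_divide right_diff_distrib)

lemma ee_left_diff: "ee ((s - t) * x) = ee (s * x) / ee (t * x)"
  by (simp add: left_diff_distrib ee_diff)

lemma ee_left_add: "ee ((s + t) * x) = ee (s * x) * ee (t * x)"
  by (simp add: distrib_right ee_add)

lemma inverse_unit: "norm z = 1 \<Longrightarrow> inverse z = cnj z" for z :: complex
  by (intro inverse_unique) (simp add: complex_norm_square[symmetric])

lemma ee_eq_1_iff: "ee t = 1 \<longleftrightarrow> t \<in> \<int>"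
proof
  assume "ee t = 1"
  then have "cos (2 * pi * t) = 1"
    by (metis ee_def cis.sel(1) one_complex.sel(1))
  then obtain n :: int where "2 * pi * t = of_int n * 2 * pi"
    by (auto simp: cos_one_2pi_int)
  then show "t \<in> \<int>" by auto
next
  assume "t \<in> \<int>"
  then show "ee t = 1"
    by (auto simp: ee_def elim!: Ints_cases)
qed

lemma ee_eq_iff: "ee s = ee t \<longleftrightarrow> s - t \<in> \<int>"
  by (simp add: ee_eq_1_iff[symmetric] ee_diff)

lemma ee_of_nat_mult: "ee (real n * t) = ee t ^ n"
  by (induction n) (auto simp: distrib_right ee_add)

lemma exp_eq_ee: "exp (2 * of_real pi * \<i> * of_real l * of_real x) = ee (l * x)"
  by (simp add: ee_def cis_conv_exp mult_ac)

section \<open>Interpolation and power sums\<close>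

lemma exists_poly_interpolation:
  fixes \<Phi> :: "'a :: field \<Rightarrow> 'a"
  assumes "finite S"
  shows "\<exists>p. \<forall>z\<in>S. poly p z = \<Phi> z"
  using assms
proof (induction S rule: finite_induct)
  case (insert w S)
  then obtain p where p: "\<And>z. z \<in> S \<Longrightarrow> poly p z = \<Phi> z" by auto
  define q where "q = (\<Prod>z\<in>S. [:- z, 1:])"
  have q0: "poly q z = 0" if "z \<in> S" for z
    unfolding q_def poly_prod using that insert(1) by (intro prod_zero) (auto intro!: bexI[of _ z])
  have qw: "poly q w \<noteq> 0"
    unfolding q_def poly_prod using insert by auto
  have "poly (p + smult ((\<Phi> w - poly p w) / poly q w) q) z = \<Phi> z" if "z \<in> insert w S" for z
    using that p q0 qw by auto
  then show ?case by blast
qed auto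

text \<open>Equality of power sums extends linearly to polynomials, and on finitely many nodes every
  function \<open>\<Phi>\<close> is a polynomial. Taking \<open>\<Phi>\<close> to be the indicator
  of one value separates the terms by node.\<close>

lemma power_sums_eq_imp_weighted_sums_eq:
  fixes a b z w :: "'j \<Rightarrow> 'a :: field"
  assumes "finite J" and pow: "\<And>k. (\<Sum>j\<in>J. a j * z j ^ k) = (\<Sum>j\<in>J. b j * w j ^ k)"
  shows "(\<Sum>j\<in>J. a j * \<Phi> (z j)) = (\<Sum>j\<in>J. b j * \<Phi> (w j))"
proof -
  have "finite (z ` J \<union> w ` J)" using assms(1) by simp
  then obtain p where p: "\<And>x. x \<in> z ` J \<union> w ` J \<Longrightarrow> poly p x = \<Phi> x"
    using exists_poly_interpolation by metis
  have eq: "(\<Sum>j\<in>J. c j * poly p (x j)) = (\<Sum>i\<le>degree p. coeff p i * (\<Sum>j\<in>J. c j * x j ^ i))"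
    for c x :: "'j \<Rightarrow> 'a"
    by (simp add: poly_altdef sum_distrib_left mult_ac) (rule sum.swap)
  have "(\<Sum>j\<in>J. a j * \<Phi> (z j)) = (\<Sum>j\<in>J. a j * poly p (z j))"
    using p by (intro sum.cong) auto
  also have "\<dots> = (\<Sum>j\<in>J. b j * poly p (w j))"
    unfolding eq pow ..
  also have "\<dots> = (\<Sum>j\<in>J. b j * \<Phi> (w j))"
    using p by (intro sum.cong) auto
  finally show ?thesis .
qed

section \<open>Cyclic subgroups of the integers and of the reals\<close>

lemma int_subgroup_cyclic:
  fixes K :: "int set"
  assumes "0 \<in> K" and diff: "\<And>m n. m \<in> K \<Longrightarrow> n \<in> K \<Longrightarrow> m - n \<in> K"
  shows "\<exists>q. K = range (\<lambda>k. q * k)"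
proof (cases "K = {0}")
  case True
  then show ?thesis by (intro exI[of _ 0]) auto
next
  case False
  have neg: "- n \<in> K" if "n \<in> K" for n
    using diff[OF assms(1) that] by simp
  have add: "m + n \<in> K" if "m \<in> K" "n \<in> K" for m n
    using diff[OF that(1) neg[OF that(2)]] by simp
  obtain n where "n \<in> K" "n \<noteq> 0" using False assms(1) by auto
  then have "\<exists>m::nat. 0 < m \<and> int m \<in> K"
    using neg[of n] by (cases "n > 0") (auto intro!: exI[of _ "nat \<bar>n\<bar>"])
  define m where "m = (LEAST m::nat. 0 < m \<and> int m \<in> K)"
  have m: "0 < m" "int m \<in> K"
    using LeastI_ex[OF \<open>\<exists>m::nat. 0 < m \<and> int m \<in> K\<close>] by (auto simp: m_def)
  have mult_nat: "int m * int k \<in> K" for k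
    by (induction k) (auto simp: assms(1) distrib_left intro!: add m)
  have mult: "int m * k \<in> K" for k
    using mult_nat[of "nat k"] neg[OF mult_nat[of "nat (- k)"]] by (cases "k \<ge> 0") auto
  have "x \<in> range (\<lambda>k. int m * k)" if "x \<in> K" for x
  proof -
    have "x mod int m \<in> K"
      using diff[OF that mult[of "x div int m"]] by (simp add: minus_mult_div_eq_mod)
    moreover have "\<not> (0 < nat (x mod int m) \<and> int (nat (x mod int m)) \<in> K)"
      using m(1) by (intro not_less_Least[of _ "\<lambda>m. 0 < m \<and> int m \<in> K", folded m_def]) (simp add: nat_less_iff)
    ultimately have "x mod int m = 0"
      using m(1) by (metis order_le_less of_nat_0_less_iff pos_mod_sign nat_0_le zero_less_nat_eq)
    then show ?thesis by (auto simp: dvd_eq_mod_eq_0[symmetric] elim!: dvdE)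
  qed
  then show ?thesis using mult by (intro exI[of _ "int m"]) auto
qed

text \<open>Multiplication by \<open>y\<close> maps \<open>G\<close> injectively into the integers,
  where its image \<open>K\<close> is cyclic. The nonzero element \<open>d\<close> excludes the
  generator 0.\<close>

lemma real_subgroup_cyclic:
  fixes G :: "real set"
  assumes "0 \<in> G" and diff: "\<And>x z. x \<in> G \<Longrightarrow> z \<in> G \<Longrightarrow> x - z \<in> G"
    and "d \<in> G" "d \<noteq> 0" and "y \<noteq> 0" and y: "\<And>x. x \<in> G \<Longrightarrow> x * y \<in> \<int>"
  obtains g where "g > 0" "G = range (\<lambda>k::int. g * of_int k)"
proof -
  define K where "K = {k::int. of_int k / y \<in> G}"
  have "\<exists>q. K = range (\<lambda>k. q * k)"
    using assms(1) by (intro int_subgroup_cyclic) (auto simp: K_def diff_divide_distrib intro: diff)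
  then obtain q where q: "K = range (\<lambda>k. q * k)" by auto
  define g where "g = of_int q / y"
  have G: "G = range (\<lambda>k::int. g * of_int k)"
  proof (intro equalityI subsetI)
    fix x assume x: "x \<in> G"
    then obtain n where n: "x * y = of_int n" using y by (auto elim: Ints_cases)
    then have "x = of_int n / y" using \<open>y \<noteq> 0\<close> by (simp add: field_simps)
    then have "n \<in> K" using x by (simp add: K_def)
    then obtain k where "n = q * k" using q by auto
    then show "x \<in> range (\<lambda>k::int. g * of_int k)"
      using \<open>x = of_int n / y\<close> by (auto simp: g_def)
  next
    fix x assume "x \<in> range (\<lambda>k::int. g * of_int k)"
    then obtain k where k: "x = of_int (q * k) / y" by (auto simp: g_def)
    have "q * k \<in> K" using q by auto
    then show "x \<in> G" using k by (simp add: K_def)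
  qed
  have "g \<noteq> 0" using G \<open>d \<in> G\<close> \<open>d \<noteq> 0\<close> by auto
  have "range (\<lambda>k::int. (- g) * of_int k) = range (\<lambda>k::int. g * of_int k)"
    by (auto intro: rev_image_eqI[where x = "- _"])
  then show thesis
    using that[of g] that[of "- g"] G \<open>g \<noteq> 0\<close> by (cases "g > 0") auto
qed

section \<open>Fibres of a union of intervals\<close>

lemma has_integral_ee:
  assumes "a \<le> b" "\<xi> \<noteq> 0"
  shows "((\<lambda>x. ee (\<xi> * x)) has_integral (ee (\<xi> * b) - ee (\<xi> * a)) / (2 * pi * \<i> * \<xi>)) {a..b}"
proof -
  define c where "c = 2 * pi * \<i> * \<xi>"
  have c: "c \<noteq> 0" using assms by (simp add: c_def)
  have ee: "ee (\<xi> * x) = exp (c * of_real x)" for x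
    by (simp add: c_def ee_def cis_conv_exp mult_ac)
  have "((\<lambda>x. exp (c * of_real x) / c) has_vector_derivative exp (c * of_real x)) (at x within {a..b})" for x
    using c by (intro has_vector_derivative_real_field[where f = "\<lambda>x. exp (c * x) / c"])
      (auto intro!: derivative_eq_intros)
  then have "((\<lambda>x. exp (c * of_real x)) has_integral exp (c * of_real b) / c - exp (c * of_real a) / c) {a..b}"
    using assms by (intro fundamental_theorem_of_calculus) auto
  then show ?thesis unfolding c_def[symmetric] by (simp add: ee diff_divide_distrib)
qed

text \<open>The constant \<open>C\<close> is common to all translates of the interval. In
  \<open>fiber_vector_eq_0\<close> this reduces the integral of a step function to a sum over the
  fibre.\<close>

lemma has_integral_ee_translate:
  assumes "a \<le> b"
  shows "\<exists>C. \<forall>t. ((\<lambda>x. ee (\<xi> * x)) has_integral ee (\<xi> * t) * C) {a + t..b + t}"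
proof (cases "\<xi> = 0")
  case True
  have "((\<lambda>x. 1 :: complex) has_integral of_real (b - a)) {a + t..b + t}" for t
    using has_integral_const_real[of "1::complex" "a + t" "b + t"] assms
    by (simp add: scaleR_conv_of_real del: of_real_diff)
  then show ?thesis using True by (auto intro!: exI[of _ "of_real (b - a)"])
next
  case False
  have "((\<lambda>x. ee (\<xi> * x)) has_integral
      ee (\<xi> * t) * ((ee (\<xi> * b) - ee (\<xi> * a)) / (2 * pi * \<i> * \<xi>))) {a + t..b + t}" for t
    using has_integral_ee[of "a + t" "b + t" \<xi>] False assms
    by (simp add: distrib_left ee_add right_diff_distrib mult_ac)
  then show ?thesis by blast
qed

lemma continuous_on_ee [continuous_intros]:
  "continuous_on S f \<Longrightarrow> continuous_on S (\<lambda>x. ee (f x))"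
  unfolding ee_def by (intro continuous_intros)

lemma borel_measurable_ee [measurable]: "(\<lambda>x. ee (c * x)) \<in> borel_measurable (lebesgue_on S)"
proof -
  have "(\<lambda>x. ee (c * x)) \<in> borel_measurable borel"
    by (intro borel_measurable_continuous_onI continuous_intros)
  then show ?thesis
    by (intro measurable_restrict_space1 measurable_completion) simp
qed

text \<open>Interpolation handles functions of the node \<open>ee t\<close>. This brings 1-periodic
  functions of \<open>t\<close>, such as the rounding error in
  \<open>ceiling_diff_Ints_cong\<close>, into that form.\<close>

lemma factor_through_ee:
  assumes "\<And>s t. s - t \<in> \<int> \<Longrightarrow> \<psi> s = \<psi> t"
  shows "\<exists>\<Phi>. \<forall>t. \<Phi> (ee t) = \<psi> t"
proof (intro exI allI)
  fix t
  have "ee (SOME s. ee s = ee t) = ee t" by (rule someI) simp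
  then show "(\<lambda>z. \<psi> (SOME s. ee s = z)) (ee t) = \<psi> t"
    by (intro assms) (simp add: ee_eq_iff)
qed

lemma ceiling_diff_Ints_cong:
  fixes s t c :: real
  assumes "s - t \<in> \<int>"
  shows "of_int \<lceil>s - c\<rceil> - s = of_int \<lceil>t - c\<rceil> - t"
proof -
  obtain k where "s - t = of_int k" using assms by (auto elim: Ints_cases)
  then have "s = t + of_int k" by simp
  then have "\<lceil>s - c\<rceil> = \<lceil>t - c\<rceil> + k"
    by (metis add_diff_eq add.commute ceiling_add_of_int diff_add_eq)
  then show ?thesis using \<open>s = t + of_int k\<close> by simp
qed

lemma geometric_sum_ee:
  assumes "A \<le> B"
  shows "(ee \<theta> - 1) * (\<Sum>n\<in>{A..<B}. ee (\<theta> * of_int n)) = ee (\<theta> * of_int B) - ee (\<theta> * of_int A)"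
  using assms
proof (induction B rule: int_ge_induct)
  case (step B)
  have "{A..<B + 1} = insert B {A..<B}" using step by auto
  then show ?case using step by (simp add: distrib_left ee_add algebra_simps)
qed simp

text \<open>The fibre arguments work for any finite number of intervals. Total length 1 removes the
  normalising factor from \<open>spec_exp\<close>.\<close>

locale interval_union =
  fixes J :: "'j set" and l u :: "'j \<Rightarrow> real"
  assumes finite_J: "finite J"
    and l_less_u: "j \<in> J \<Longrightarrow> l j < u j"
    and disjoint: "i \<in> J \<Longrightarrow> j \<in> J \<Longrightarrow> i \<noteq> j \<Longrightarrow> {l i..u i} \<inter> {l j..u j} = {}"
    and total_length: "(\<Sum>j\<in>J. u j - l j) = 1"
begin

definition \<Omega> :: "real set" where
  "\<Omega> = (\<Union>j\<in>J. {l j..u j})"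

text \<open>Up to the factor \<open>2 pi i \<xi>\<close>, the Fourier transform of the indicator of \<open>\<Omega>\<close> at \<open>\<xi>\<close> is the
  difference of the two sides.\<close>

definition D :: "real \<Rightarrow> bool" where
  "D \<xi> \<longleftrightarrow> (\<Sum>j\<in>J. ee (\<xi> * u j)) = (\<Sum>j\<in>J. ee (\<xi> * l j))"

text \<open>Only countably many \<open>y\<close> fail this, and for all others closed and half-open
  intervals have the same fibres.\<close>

definition generic :: "real \<Rightarrow> real \<Rightarrow> bool" where
  "generic g y \<longleftrightarrow> (\<forall>n::int. \<forall>j\<in>J. y + of_int n / g \<noteq> l j \<and> y + of_int n / g \<noteq> u j)"

definition fiber :: "real \<Rightarrow> real \<Rightarrow> int set" where
  "fiber g y = {n. y + of_int n / g \<in> \<Omega>}"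

lemma has_integral_\<Omega>:
  fixes f :: "real \<Rightarrow> 'a :: banach"
  assumes "\<And>j. j \<in> J \<Longrightarrow> (f has_integral I j) {l j..u j}"
  shows "(f has_integral (\<Sum>j\<in>J. I j)) \<Omega>"
  unfolding \<Omega>_def
  using finite_J assms disjoint by (intro has_integral_UN) (auto simp: pairwise_def)

lemma \<Omega>_lmeasurable [simp]: "\<Omega> \<in> lmeasurable"
  unfolding \<Omega>_def using finite_J by (intro fmeasurable.finite_UN) auto

lemma \<Omega>_sets [simp, measurable]: "\<Omega> \<in> sets lebesgue"
  using \<Omega>_lmeasurable by blast

lemma has_integral_\<Omega>_1: "((\<lambda>x. 1 :: real) has_integral 1) \<Omega>"
proof -
  have "((\<lambda>x. 1 :: real) has_integral (u j - l j)) {l j..u j}" if "j \<in> J" for j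
    using has_integral_const_real[of "1::real" "l j" "u j"] l_less_u[OF that] by simp
  then show ?thesis
    using has_integral_\<Omega>[of "\<lambda>x. 1 :: real" "\<lambda>j. u j - l j"] total_length by simp
qed

lemma measure_\<Omega> [simp]: "measure lebesgue \<Omega> = 1"
  using has_integral_\<Omega>_1 by (simp add: lmeasure_integral integral_unique)

lemma spec_exp_eq: "x \<in> \<Omega> \<Longrightarrow> spec_exp \<Omega> c x = ee (c * x)"
  by (simp add: spec_exp_def exp_eq_ee)

lemma integrable_bounded:
  fixes f :: "real \<Rightarrow> 'a :: euclidean_space"
  assumes "f \<in> borel_measurable (lebesgue_on \<Omega>)" "\<And>x. norm (f x) \<le> B"
  shows "integrable (lebesgue_on \<Omega>) f"
proof -
  interpret finite_measure "lebesgue_on \<Omega>"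
    by (rule finite_measure_lebesgue_on) simp
  show ?thesis using assms by (intro integrable_const_bound[where B = B]) auto
qed

lemma LINT_\<Omega>_eq:
  fixes f :: "real \<Rightarrow> 'a :: euclidean_space"
  assumes "f \<in> borel_measurable (lebesgue_on \<Omega>)" "\<And>x. norm (f x) \<le> B" "(f has_integral I) \<Omega>"
  shows "(LINT x|lebesgue_on \<Omega>. f x) = I"
  using lebesgue_integral_eq_integral[OF integrable_bounded[OF assms(1,2)]] assms(3)
  by (simp add: integral_unique)

lemma LINT_ee: "\<xi> \<noteq> 0 \<Longrightarrow> (LINT x|lebesgue_on \<Omega>. ee (\<xi> * x))
    = ((\<Sum>j\<in>J. ee (\<xi> * u j)) - (\<Sum>j\<in>J. ee (\<xi> * l j))) / (2 * pi * \<i> * \<xi>)"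
  unfolding sum_subtractf[symmetric] sum_divide_distrib
  using l_less_u by (intro LINT_\<Omega>_eq[where B = 1] has_integral_\<Omega> has_integral_ee) (auto simp: less_imp_le)

text \<open>As the right endpoint is never hit, both bounds are ceilings of the same form, so one
  function of the endpoint serves for left and right endpoints in the sums below.\<close>

lemma fiber_piece:
  assumes "g > 0" "generic g y" "j \<in> J"
  shows "{n::int. y + of_int n / g \<in> {l j..u j}} = {\<lceil>g * l j - g * y\<rceil>..<\<lceil>g * u j - g * y\<rceil>}"
proof (intro set_eqI)
  fix n :: int
  have "y + of_int n / g \<noteq> u j" using assms by (auto simp: generic_def)
  then have "y + of_int n / g \<in> {l j..u j} \<longleftrightarrow> l j \<le> y + of_int n / g \<and> y + of_int n / g < u j"
    by auto
  also have "\<dots> \<longleftrightarrow> g * l j - g * y \<le> of_int n \<and> of_int n < g * u j - g * y"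
    using assms(1) by (simp add: field_simps)
  finally show "n \<in> {n::int. y + of_int n / g \<in> {l j..u j}} \<longleftrightarrow> n \<in> {\<lceil>g * l j - g * y\<rceil>..<\<lceil>g * u j - g * y\<rceil>}"
    by (simp add: ceiling_le_iff less_ceiling_iff)
qed

lemma fiber_eq_UN:
  assumes "g > 0" "generic g y"
  shows "fiber g y = (\<Union>j\<in>J. {\<lceil>g * l j - g * y\<rceil>..<\<lceil>g * u j - g * y\<rceil>})"
  using fiber_piece[OF assms] by (auto simp: fiber_def \<Omega>_def)

lemma finite_fiber:
  assumes "g > 0" "generic g y"
  shows "finite (fiber g y)"
  using finite_J by (auto simp: fiber_eq_UN[OF assms])

lemma sum_fiber:
  assumes "g > 0" "generic g y"
  shows "(\<Sum>n\<in>fiber g y. f n) = (\<Sum>j\<in>J. \<Sum>n\<in>{\<lceil>g * l j - g * y\<rceil>..<\<lceil>g * u j - g * y\<rceil>}. f n)"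
proof -
  have "{\<lceil>g * l i - g * y\<rceil>..<\<lceil>g * u i - g * y\<rceil>} \<inter> {\<lceil>g * l j - g * y\<rceil>..<\<lceil>g * u j - g * y\<rceil>} = {}"
    if "i \<in> J" "j \<in> J" "i \<noteq> j" for i j
    using disjoint[OF that] fiber_piece[OF assms that(1)] fiber_piece[OF assms that(2)] by blast
  then show ?thesis
    unfolding fiber_eq_UN[OF assms] using finite_J by (intro sum.UNION_disjoint) auto
qed

lemma ceiling_l_le_u: "g > 0 \<Longrightarrow> j \<in> J \<Longrightarrow> \<lceil>g * l j - g * y\<rceil> \<le> \<lceil>g * u j - g * y\<rceil>"
  using l_less_u[of j] by (intro ceiling_mono) auto

text \<open>Read \<open>D (\<delta> + g * k)\<close> as an equality of \<open>k\<close>-th power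
  sums with nodes \<open>ee (g * x)\<close> and weights \<open>ee (\<delta> * x)\<close>, where
  \<open>x\<close> runs through the endpoints. An indicator \<open>\<Phi>\<close> then balances each
  class of endpoints modulo 1/g separately.\<close>

lemma D_periodic_imp_weighted:
  assumes "\<And>k::nat. D (\<delta> + g * real k)"
  shows "(\<Sum>j\<in>J. ee (\<delta> * u j) * \<Phi> (ee (g * u j))) = (\<Sum>j\<in>J. ee (\<delta> * l j) * \<Phi> (ee (g * l j)))"
proof (rule power_sums_eq_imp_weighted_sums_eq[OF finite_J,
      where a = "\<lambda>j. ee (\<delta> * u j)" and b = "\<lambda>j. ee (\<delta> * l j)"
        and z = "\<lambda>j. ee (g * u j)" and w = "\<lambda>j. ee (g * l j)"])
  fix k :: nat
  have "ee (\<delta> * x) * ee (g * x) ^ k = ee ((\<delta> + g * real k) * x)" for x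
    by (simp add: ee_of_nat_mult[symmetric] ee_add[symmetric] algebra_simps)
  then show "(\<Sum>j\<in>J. ee (\<delta> * u j) * ee (g * u j) ^ k) = (\<Sum>j\<in>J. ee (\<delta> * l j) * ee (g * l j) ^ k)"
    using assms[of k] by (simp add: D_def)
qed

text \<open>As \<open>y\<close> moves, the sum over the fibre is locally constant and its jumps occur at the endpoints;
  the endpoints in one class modulo \<open>1/g\<close> have jumps that cancel.\<close>

lemma fiber_sum_eq_0:
  assumes "g > 0" "generic g y" and D: "\<And>k::nat. D (\<delta> + g * real k)" and "\<delta> / g \<notin> \<int>"
  shows "(\<Sum>n\<in>fiber g y. ee (\<delta> / g * of_int n)) = 0"
proof -
  define \<theta> where "\<theta> = \<delta> / g"
  have "\<theta> * (of_int \<lceil>s - g * y\<rceil> - s) = \<theta> * (of_int \<lceil>t - g * y\<rceil> - t)" if "s - t \<in> \<int>" for s t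
    using ceiling_diff_Ints_cong[OF that, of "g * y"] by simp
  then obtain \<Phi> where \<Phi>: "\<And>t. \<Phi> (ee t) = ee (\<theta> * (of_int \<lceil>t - g * y\<rceil> - t))"
    using factor_through_ee[of "\<lambda>t. ee (\<theta> * (of_int \<lceil>t - g * y\<rceil> - t))"] by metis
  \<comment> \<open>With \<open>t = g * x\<close> one has
    \<open>\<theta> * t = \<delta> * x\<close>; the remaining phase depends on \<open>t\<close>
    modulo 1 only. The geometric sums below leave just these endpoint terms, which balance.\<close>
  have split: "ee (\<theta> * of_int \<lceil>g * x - g * y\<rceil>) = ee (\<delta> * x) * \<Phi> (ee (g * x))" for x
    using assms(1) by (simp add: \<Phi> ee_add[symmetric] \<theta>_def field_simps)
  have "(ee \<theta> - 1) * (\<Sum>n\<in>fiber g y. ee (\<theta> * of_int n))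
      = (\<Sum>j\<in>J. ee (\<theta> * of_int \<lceil>g * u j - g * y\<rceil>) - ee (\<theta> * of_int \<lceil>g * l j - g * y\<rceil>))"
    using assms(1) by (simp add: sum_fiber[OF assms(1,2)] sum_distrib_left[of _ _ J] geometric_sum_ee ceiling_l_le_u)
  also have "\<dots> = 0"
    by (simp add: split sum_subtractf D_periodic_imp_weighted[OF D])
  finally show ?thesis
    using assms(4) by (simp add: \<theta>_def ee_eq_1_iff)
qed

text \<open>The analogue of \<open>fiber_sum_eq_0\<close> for \<open>\<delta> = 0\<close>. The
  rounding error at an endpoint is 1-periodic in \<open>g * x\<close>, so its totals over right and
  left endpoints agree. What remains of the count is \<open>g\<close> times the total length
  1.\<close>

lemma card_fiber:
  assumes "g > 0" "generic g y" and D: "\<And>k::nat. D (g * real k)"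
  shows "real (card (fiber g y)) = g"
proof -
  obtain \<Phi> where \<Phi>: "\<And>t. \<Phi> (ee t) = complex_of_real (of_int \<lceil>t - g * y\<rceil> - t)"
    using factor_through_ee[of "\<lambda>t. complex_of_real (of_int \<lceil>t - g * y\<rceil> - t)"] ceiling_diff_Ints_cong
    by metis
  have "(\<Sum>j\<in>J. \<Phi> (ee (g * u j))) = (\<Sum>j\<in>J. \<Phi> (ee (g * l j)))"
    using D_periodic_imp_weighted[of 0 g] D by simp
  then have "complex_of_real (\<Sum>j\<in>J. of_int \<lceil>g * u j - g * y\<rceil> - g * u j)
      = complex_of_real (\<Sum>j\<in>J. of_int \<lceil>g * l j - g * y\<rceil> - g * l j)"
    by (simp only: \<Phi> of_real_sum)
  then have *: "(\<Sum>j\<in>J. of_int \<lceil>g * u j - g * y\<rceil> - g * u j) = (\<Sum>j\<in>J. of_int \<lceil>g * l j - g * y\<rceil> - g * l j)"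
    by (simp only: of_real_eq_iff)
  have "real (card (fiber g y)) = (\<Sum>n\<in>fiber g y. 1 :: real)" by simp
  also have "\<dots> = (\<Sum>j\<in>J. of_int \<lceil>g * u j - g * y\<rceil> - of_int \<lceil>g * l j - g * y\<rceil>)"
    unfolding sum_fiber[OF assms(1,2)]
    using ceiling_l_le_u[OF assms(1), of _ y] by (intro sum.cong) auto
  also have "\<dots> = g * (\<Sum>j\<in>J. u j - l j)"
    using * by (simp add: sum_subtractf sum_distrib_left right_diff_distrib)
  finally show ?thesis by (simp add: total_length)
qed

lemma countable_not_generic: "countable {y. \<not> generic g y}"
proof -
  have "{y. \<not> generic g y} \<subseteq> (\<Union>n::int. \<Union>j\<in>J. {l j - of_int n / g, u j - of_int n / g})"
  proof
    fix y assume "y \<in> {y. \<not> generic g y}"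
    then obtain n :: int and j where "j \<in> J" "y + of_int n / g = l j \<or> y + of_int n / g = u j"
      by (auto simp: generic_def)
    then have "j \<in> J" "y = l j - of_int n / g \<or> y = u j - of_int n / g" by linarith+
    then show "y \<in> (\<Union>n::int. \<Union>j\<in>J. {l j - of_int n / g, u j - of_int n / g})" by blast
  qed
  then show ?thesis
    by (rule countable_subset) (use finite_J in \<open>auto intro: countable_finite\<close>)
qed

lemma exists_generic: "\<exists>y. generic g y"
proof (rule ccontr)
  assume "\<nexists>y. generic g y"
  then have "{y. \<not> generic g y} = UNIV" by auto
  then show False using countable_not_generic[of g] uncountable_UNIV_real by simp
qed

end

section \<open>Spectra\<close>

locale spectral_intervals = interval_union J l u
  for J :: "'j set" and l u :: "'j \<Rightarrow> real" +
  fixes \<Lambda> :: "real set"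
  assumes spectral: "spectral_pair \<Omega> \<Lambda>"
begin

lemma D_diff:
  assumes "x \<in> \<Lambda>" "y \<in> \<Lambda>"
  shows "D (x - y)"
proof (cases "x = y")
  case True
  then show ?thesis by (simp add: D_def)
next
  case False
  have "0 = L2_inner (lebesgue_on \<Omega>) (spec_exp \<Omega> x) (spec_exp \<Omega> y)"
    using spectral assms False by (simp add: spectral_pair_def orthonormal_basis_L2_def)
  also have "\<dots> = (LINT t|lebesgue_on \<Omega>. ee ((x - y) * t))"
    unfolding L2_inner_def
    by (intro Bochner_Integration.integral_cong)
      (auto simp: spec_exp_eq cnj_ee ee_add[symmetric] algebra_simps)
  also have "\<dots> = ((\<Sum>j\<in>J. ee ((x - y) * u j)) - (\<Sum>j\<in>J. ee ((x - y) * l j))) / (2 * pi * \<i> * of_real (x - y))"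
    using False by (subst LINT_ee) auto
  finally show ?thesis using False by (auto simp: D_def)
qed

lemma orthogonal_imp_LINT_eq_0:
  assumes f: "f \<in> borel_measurable (lebesgue_on \<Omega>)" "\<And>x. norm (f x) \<le> B"
    and orth: "\<And>\<xi>. \<xi> \<in> \<Lambda> \<Longrightarrow> (LINT x|lebesgue_on \<Omega>. f x * ee (- \<xi> * x)) = 0"
  shows "(LINT x|lebesgue_on \<Omega>. (norm (f x))\<^sup>2) = 0"
proof (rule orthonormal_basis_L2_orthogonal_zero)
  show "orthonormal_basis_L2 (lebesgue_on \<Omega>) \<Lambda> (spec_exp \<Omega>)"
    using spectral by (simp add: spectral_pair_def)
  have "integrable (lebesgue_on \<Omega>) (\<lambda>x. (norm (f x))\<^sup>2)"
    using f by (intro integrable_bounded[where B = "B\<^sup>2"]) (auto intro!: power_mono)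
  then show "f \<in> L2_space (lebesgue_on \<Omega>)"
    using f by (simp add: L2_space_def)
  fix \<xi> assume "\<xi> \<in> \<Lambda>"
  have "L2_inner (lebesgue_on \<Omega>) f (spec_exp \<Omega> \<xi>) = (LINT x|lebesgue_on \<Omega>. f x * ee (- \<xi> * x))"
    unfolding L2_inner_def
    by (intro Bochner_Integration.integral_cong) (auto simp: spec_exp_eq cnj_ee)
  then show "L2_inner (lebesgue_on \<Omega>) f (spec_exp \<Omega> \<xi>) = 0"
    using orth[OF \<open>\<xi> \<in> \<Lambda>\<close>] by simp
qed

text \<open>Otherwise the exponential of frequency \<open>x\<close> would be orthogonal to the whole
  basis and hence zero, although its norm is 1. Arguing from \<open>x \<notin> \<Lambda>\<close>
  matters, because \<open>D (x - \<xi>)\<close> expresses orthogonality only for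
  \<open>x \<noteq> \<xi>\<close>.\<close>

lemma maximal:
  assumes "\<And>\<xi>. \<xi> \<in> \<Lambda> \<Longrightarrow> D (x - \<xi>)"
  shows "x \<in> \<Lambda>"
proof (rule ccontr)
  assume x: "x \<notin> \<Lambda>"
  have "(LINT t|lebesgue_on \<Omega>. (norm (ee (x * t)))\<^sup>2) = 0"
  proof (rule orthogonal_imp_LINT_eq_0[where B = 1])
    fix \<xi> assume \<xi>: "\<xi> \<in> \<Lambda>"
    then have ne: "x - \<xi> \<noteq> 0" using x by auto
    have "ee (x * t) * ee (- \<xi> * t) = ee ((x - \<xi>) * t)" for t
      by (simp add: ee_add[symmetric] algebra_simps)
    then show "(LINT t|lebesgue_on \<Omega>. ee (x * t) * ee (- \<xi> * t)) = 0"
      using LINT_ee[OF ne] assms[OF \<xi>] by (simp add: D_def)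
  qed auto
  moreover have "(LINT t|lebesgue_on \<Omega>. 1 :: real) = 1"
    using has_integral_\<Omega>_1 by (intro LINT_\<Omega>_eq[where B = 1]) auto
  ultimately show False by simp
qed

lemma \<Lambda>_nonempty: "\<Lambda> \<noteq> {}"
  using maximal by auto

text \<open>Test completeness against functions that are constant on small translates \<open>I + n/g\<close> of one interval.\<close>

lemma fiber_vector_eq_0:
  assumes g: "g > 0" and y: "generic g y"
    and \<Lambda>: "\<And>\<xi>. \<xi> \<in> \<Lambda> \<Longrightarrow> (\<Sum>n\<in>fiber g y. v n * ee (- \<xi> * of_int n / g)) = 0"
    and n: "n \<in> fiber g y"
  shows "v n = 0"
proof -
  define F where "F = fiber g y"
  have F: "finite F" unfolding F_def by (rule finite_fiber[OF g y])
  \<comment> \<open>All points of the fibre can be shifted together by a small amount without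
    leaving the interiors of the intervals.\<close>
  define U where "U = (\<Inter>n\<in>F. (\<lambda>t. t + of_int n / g) -` (\<Union>j\<in>J. {l j<..<u j}))"
  have "open U"
    unfolding U_def using F by (intro open_INT ballI open_vimage continuous_intros) auto
  moreover have "y \<in> U"
  proof -
    have "y + of_int n / g \<in> (\<Union>j\<in>J. {l j<..<u j})" if "n \<in> F" for n
    proof -
      obtain j where "j \<in> J" "y + of_int n / g \<in> {l j..u j}"
        using \<open>n \<in> F\<close> by (auto simp: F_def fiber_def \<Omega>_def)
      moreover from this have "y + of_int n / g \<noteq> l j" "y + of_int n / g \<noteq> u j"
        using y by (auto simp: generic_def)
      ultimately show ?thesis by force
    qed
    then show ?thesis by (auto simp: U_def)
  qed
  ultimately obtain e where e: "e > 0" "cball y e \<subseteq> U"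
    by (meson open_contains_cball)
  \<comment> \<open>The bound \<open>e\<close> keeps the small intervals inside
    \<open>\<Omega>\<close>; the bound \<open>1 / (4 * g)\<close> makes their length at most half of
    the spacing \<open>1 / g\<close>, so that they are disjoint.\<close>
  define \<epsilon> where "\<epsilon> = min e (1 / (4 * g))"
  have \<epsilon>: "\<epsilon> > 0" "\<epsilon> \<le> e" "\<epsilon> \<le> 1 / (4 * g)"
    using e g by (auto simp: \<epsilon>_def)
  define A where "A n = {y - \<epsilon> + of_int n / g..y + \<epsilon> + of_int n / g}" for n :: int
  have A_sub: "A n \<subseteq> \<Omega>" if "n \<in> F" for n
  proof
    fix x assume "x \<in> A n"
    then have "x - of_int n / g \<in> cball y e"
      using \<epsilon> by (auto simp: A_def dist_real_def)
    then have "x - of_int n / g \<in> U" using e by auto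
    then have "x - of_int n / g + of_int n / g \<in> (\<Union>j\<in>J. {l j<..<u j})"
      using that unfolding U_def by blast
    then show "x \<in> \<Omega>" by (force simp: \<Omega>_def)
  qed
  have A_disj: "m = n" if "x \<in> A m" "x \<in> A n" for x m n
  proof -
    have "\<bar>of_int m / g - of_int n / g\<bar> \<le> 2 * \<epsilon>"
      using that by (auto simp: A_def)
    also have "\<dots> < 1 / g"
      using \<epsilon> g by (simp add: field_simps)
    finally have "\<bar>of_int m - of_int n :: real\<bar> < 1"
      using g by (simp add: diff_divide_distrib[symmetric] divide_less_cancel)
    then show ?thesis by linarith
  qed
  define f where "f x = (\<Sum>m\<in>F. if x \<in> A m then v m else 0)" for x
  have f_eq: "f x = v m" if "x \<in> A m" "m \<in> F" for x m
  proof -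
    have "f x = (\<Sum>k\<in>F. if k = m then v m else 0)"
      unfolding f_def using A_disj that by (intro sum.cong) auto
    then show ?thesis using F that by simp
  qed
  have [measurable]: "A m \<in> sets lebesgue" for m by (simp add: A_def)
  have meas: "(\<lambda>x. if x \<in> A m then c else 0) \<in> borel_measurable (lebesgue_on \<Omega>)" for m and c :: complex
  proof -
    have "(\<lambda>x. if x \<in> A m then c else 0) \<in> borel_measurable lebesgue" by measurable
    then show ?thesis by (rule measurable_restrict_space1)
  qed
  have f_meas: "f \<in> borel_measurable (lebesgue_on \<Omega>)"
    unfolding f_def by (intro borel_measurable_sum meas)
  have f_bound: "norm (f x) \<le> (\<Sum>m\<in>F. norm (v m))" for x
    unfolding f_def by (rule order_trans[OF norm_sum]) (intro sum_mono, auto)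
  have "(LINT x|lebesgue_on \<Omega>. (norm (f x))\<^sup>2) = 0"
  proof (rule orthogonal_imp_LINT_eq_0[OF f_meas f_bound])
    fix \<xi> assume "\<xi> \<in> \<Lambda>"
    obtain C where C: "\<And>t. ((\<lambda>x. ee (- \<xi> * x)) has_integral ee (- \<xi> * t) * C) {y - \<epsilon> + t..y + \<epsilon> + t}"
      using has_integral_ee_translate[of "y - \<epsilon>" "y + \<epsilon>" "- \<xi>"] \<epsilon> by auto
    have eq: "f x * ee (- \<xi> * x) = (\<Sum>m\<in>F. if x \<in> A m then v m * ee (- \<xi> * x) else 0)" for x
      unfolding f_def sum_distrib_right by (intro sum.cong) auto
    have "((\<lambda>x. if x \<in> A m then v m * ee (- \<xi> * x) else 0) has_integral
        v m * (ee (- \<xi> * (of_int m / g)) * C)) \<Omega>" if "m \<in> F" for m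
      using C[of "of_int m / g"] A_sub[OF that]
      by (subst has_integral_restrict) (auto simp: A_def intro!: has_integral_mult_right)
    then have "((\<lambda>x. f x * ee (- \<xi> * x)) has_integral
        (\<Sum>m\<in>F. v m * (ee (- \<xi> * (of_int m / g)) * C))) \<Omega>"
      unfolding eq using F by (intro has_integral_sum) auto
    moreover have "(\<Sum>m\<in>F. v m * (ee (- \<xi> * (of_int m / g)) * C)) = 0"
      using \<Lambda>[OF \<open>\<xi> \<in> \<Lambda>\<close>] by (simp add: F_def sum_distrib_right[symmetric] mult.assoc[symmetric])
    moreover have "norm (f x * ee (- \<xi> * x)) \<le> (\<Sum>m\<in>F. norm (v m))" for x
      using f_bound[of x] by (simp add: norm_mult)
    ultimately show "(LINT x|lebesgue_on \<Omega>. f x * ee (- \<xi> * x)) = 0"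
      using f_meas by (intro LINT_\<Omega>_eq[where B = "\<Sum>m\<in>F. norm (v m)"] borel_measurable_times borel_measurable_ee) auto
  qed
  moreover have "integrable (lebesgue_on \<Omega>) (\<lambda>x. (norm (f x))\<^sup>2)"
    using f_meas f_bound by (intro integrable_bounded[where B = "(\<Sum>m\<in>F. norm (v m))\<^sup>2"]) (auto intro!: power_mono)
  ultimately have "AE x in lebesgue_on \<Omega>. f x = 0"
    by (subst (asm) integral_nonneg_eq_0_iff_AE) auto
  then have AE: "AE x in lebesgue. x \<in> \<Omega> \<longrightarrow> f x = 0"
    by (subst (asm) AE_restrict_space_iff) auto
  show "v n = 0"
  proof (rule ccontr)
    assume "v n \<noteq> 0"
    have "n \<in> F" using n by (simp add: F_def)
    have "AE x in lebesgue. x \<notin> A n"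
      using AE by eventually_elim (use A_sub[OF \<open>n \<in> F\<close>] f_eq[OF _ \<open>n \<in> F\<close>] \<open>v n \<noteq> 0\<close> in auto)
    then have "A n \<in> null_sets lebesgue"
      by (subst (asm) AE_iff_null_sets[symmetric]) auto
    then have "negligible (A n)" by (simp add: negligible_iff_null_sets)
    then show False
      using \<epsilon> negligible_interval(1)[of "y - \<epsilon> + of_int n / g" "y + \<epsilon> + of_int n / g"]
      by (simp add: A_def)
  qed
qed

end

section \<open>Spectra that are finite unions of cosets of a lattice\<close>

locale coset_spectrum = spectral_intervals J l u \<Lambda>
  for J :: "'j set" and l u \<Lambda> +
  fixes g :: real and R :: "real set"
  assumes g_pos: "g > 0" and finite_R: "finite R"
    and \<Lambda>_eq: "\<Lambda> = {x + g * of_int k |x k::int. x \<in> R}"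
    and distinct_cosets: "x \<in> R \<Longrightarrow> y \<in> R \<Longrightarrow> x \<noteq> y \<Longrightarrow> (x - y) / g \<notin> \<int>"
begin

lemma R_nonempty: "R \<noteq> {}"
  using \<Lambda>_eq \<Lambda>_nonempty by auto

lemma coset_mem: "x \<in> R \<Longrightarrow> x + g * of_int k \<in> \<Lambda>"
  using \<Lambda>_eq by auto

lemma D_coset:
  assumes "x \<in> R" "y \<in> R"
  shows "D (x - y + g * real k)"
  using D_diff[OF coset_mem[OF assms(1), of "int k"] coset_mem[OF assms(2), of 0]]
  by (simp add: algebra_simps)

lemma fiber_orthogonal:
  assumes "generic g y" "x \<in> R" "z \<in> R" "x \<noteq> z"
  shows "(\<Sum>n\<in>fiber g y. ee ((x - z) / g * of_int n)) = 0"
  using assms by (intro fiber_sum_eq_0 g_pos D_coset distinct_cosets) auto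

lemma card_fiber_eq_g:
  assumes "generic g y"
  shows "real (card (fiber g y)) = g"
proof -
  obtain x where "x \<in> R" using R_nonempty by auto
  then show ?thesis using D_coset[of x x] by (intro card_fiber g_pos assms) auto
qed

text \<open>On a fibre \<open>F\<close> the vectors \<open>ee (x / g * n)\<close>,
  \<open>x \<in> R\<close>, are orthogonal with squared norm \<open>N = card F\<close>, and by
  completeness no nonzero vector is orthogonal to all of them. So they form a basis.\<close>

lemma card_fiber_eq_card_R:
  assumes y: "generic g y"
  shows "card (fiber g y) = card R"
proof -
  define F where "F = fiber g y"
  define N where "N = complex_of_nat (card F)"
  have F: "finite F" unfolding F_def by (rule finite_fiber[OF g_pos y])
  have "card F \<noteq> 0" using card_fiber_eq_g[OF y] g_pos by (auto simp: F_def)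
  then have N: "N \<noteq> 0" and "F \<noteq> {}" by (auto simp: N_def)
  then obtain m where m: "m \<in> F" by auto
  \<comment> \<open>The unit vector at \<open>m\<close> minus its projection to the span of these
    vectors. It must vanish, and its entry at \<open>m\<close> is
    \<open>1 - card R / N\<close>.\<close>
  define v where "v n = (if n = m then 1 else 0) - (\<Sum>x\<in>R. ee (x / g * of_int (n - m))) / N" for n
  have "v m = 0"
  proof (rule fiber_vector_eq_0[OF g_pos y])
    show "m \<in> fiber g y" using m by (simp add: F_def)
    fix \<xi> assume "\<xi> \<in> \<Lambda>"
    then obtain z k where z: "z \<in> R" and \<xi>: "\<xi> = z + g * of_int k"
      using \<Lambda>_eq by auto
    have ee: "ee (- \<xi> * of_int n / g) = ee (- (z / g * of_int n))" for n :: int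
      using g_pos by (simp add: ee_eq_iff \<xi> field_simps)
    have inner: "(\<Sum>n\<in>F. ee ((x - z) / g * of_int n)) = (if x = z then N else 0)" if "x \<in> R" for x
    proof (cases "x = z")
      case True
      then show ?thesis by (simp add: N_def)
    next
      case False
      then show ?thesis using fiber_orthogonal[OF y that z] by (simp add: F_def)
    qed
    have "(\<Sum>n\<in>F. v n * ee (- \<xi> * of_int n / g))
        = (\<Sum>n\<in>F. (if n = m then 1 else 0) * ee (- (z / g * of_int n)))
          - (\<Sum>n\<in>F. \<Sum>x\<in>R. ee (x / g * of_int (n - m)) * ee (- (z / g * of_int n))) / N"
      by (simp only: ee v_def left_diff_distrib sum_subtractf sum_divide_distrib sum_distrib_right times_divide_eq_left)
    also have "(\<Sum>n\<in>F. (if n = m then 1 else 0) * ee (- (z / g * of_int n))) = ee (- (z / g * of_int m))"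
      using F m by (simp add: if_distrib[of "\<lambda>c. c * _"] cong: if_cong)
    also have "(\<Sum>n\<in>F. \<Sum>x\<in>R. ee (x / g * of_int (n - m)) * ee (- (z / g * of_int n)))
        = (\<Sum>x\<in>R. ee (- (x / g * of_int m)) * (\<Sum>n\<in>F. ee ((x - z) / g * of_int n)))"
      by (subst sum.swap)
        (simp add: sum_distrib_left ee_add[symmetric] right_diff_distrib diff_divide_distrib left_diff_distrib algebra_simps)
    also have "\<dots> = (\<Sum>x\<in>R. if x = z then ee (- (z / g * of_int m)) * N else 0)"
      by (intro sum.cong refl, subst inner) auto
    also have "\<dots> = ee (- (z / g * of_int m)) * N"
      using finite_R z by simp
    finally show "(\<Sum>n\<in>fiber g y. v n * ee (- \<xi> * of_int n / g)) = 0"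
      using N by (simp add: F_def)
  qed
  then have "N = of_nat (card R)" using N by (simp add: v_def field_simps)
  then show ?thesis by (simp add: N_def F_def)
qed

text \<open>Both numbers are the size of a generic fibre. In other words, the density
  \<open>card R / g\<close> of the spectrum equals the measure of \<open>\<Omega>\<close>.\<close>

lemma g_eq_card_R: "g = real (card R)"
  using exists_generic[of g] card_fiber_eq_g card_fiber_eq_card_R by metis

end

section \<open>Spectra with at most three cosets tile\<close>

text \<open>Conjugation inverts unit numbers, so the sum of the inverses vanishes too, and with it
  the second elementary symmetric function. Eliminating \<open>c\<close> leaves
  \<open>a\<^sup>2 + a * b + b\<^sup>2 = 0\<close>, a factor of \<open>a ^ 3 - b ^ 3\<close> that is
  nonzero for \<open>a = b\<close>.\<close>

lemma three_unit_numbers_sum_0: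
  fixes a b c :: complex
  assumes "a + b + c = 0" "norm a = 1" "norm b = 1" "norm c = 1"
  shows "a \<noteq> b" "a ^ 3 = b ^ 3"
proof -
  have "inverse a + inverse b + inverse c = cnj (a + b + c)"
    by (simp add: inverse_unit assms(2-4))
  then have "inverse a + inverse b + inverse c = 0" using assms by simp
  moreover have "a \<noteq> 0" "b \<noteq> 0" "c \<noteq> 0" using assms by auto
  ultimately have "a * b + b * c + c * a = 0" by (simp add: field_simps)
  moreover have c: "c = - (a + b)" using minus_unique[OF assms(1)] by simp
  ultimately have *: "a\<^sup>2 + a * b + b\<^sup>2 = 0"
    by (simp add: power2_eq_square algebra_simps add_eq_0_iff)
  have "a ^ 3 - b ^ 3 = (a - b) * (a\<^sup>2 + a * b + b\<^sup>2)"
    by (simp add: power2_eq_square power3_eq_cube algebra_simps)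
  then show "a ^ 3 = b ^ 3" using * by simp
  show "a \<noteq> b"
  proof
    assume "a = b"
    then have "3 * a\<^sup>2 = 0" using * by (simp add: power2_eq_square)
    then show False using \<open>a \<noteq> 0\<close> by simp
  qed
qed

context interval_union
begin

text \<open>Distinct elements \<open>m, n\<close> of a fibre are congruent modulo \<open>q\<close>, where \<open>{n. p \<theta> n \<in> \<int>} = q\<int>\<close>, but
  not modulo \<open>p q\<close>. So \<open>{n. p dvd n div q}\<close> meets every fibre exactly once.\<close>

lemma tiles_if_fibers_split:
  assumes g: "g > 0" and "p > 0"
    and card: "\<And>y. generic g y \<Longrightarrow> card (fiber g y) = p"
    and split: "\<And>y m n. generic g y \<Longrightarrow> m \<in> fiber g y \<Longrightarrow> n \<in> fiber g y \<Longrightarrow> m \<noteq> n \<Longrightarrow>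
      real p * \<theta> * of_int (m - n) \<in> \<int> \<and> \<theta> * of_int (m - n) \<notin> \<int>"
  shows "tiles_by_translations \<Omega>"
proof -
  define K where "K = {n::int. real p * \<theta> * of_int n \<in> \<int>}"
  have "\<exists>q. K = range (\<lambda>k. q * k)"
    by (rule int_subgroup_cyclic) (auto simp: K_def right_diff_distrib)
  then obtain q where q: "K = range (\<lambda>k. q * k)" by auto
  \<comment> \<open>If \<open>q = 0\<close>, no fibre has two points, so \<open>p = 1\<close>; then
    \<open>n div 0 = 0\<close> makes \<open>N\<close> the set of all integers, as required.\<close>
  define N where "N = {n. int p dvd n div q}"
  have unique: "\<exists>!n. n \<in> fiber g y \<and> n \<in> N" if y: "generic g y" for y
  proof -
    define h where "h n = nat ((n div q) mod int p)" for n
    \<comment> \<open>Two elements of a fibre differ by a multiple of \<open>q\<close>; with equal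
      residues they would differ by a multiple of \<open>p * q\<close>, against
      \<open>split\<close>. As a fibre has \<open>p\<close> elements, every residue occurs exactly
      once.\<close>
    have "inj_on h (fiber g y)"
    proof (rule inj_onI, rule ccontr)
      fix m n assume mn: "m \<in> fiber g y" "n \<in> fiber g y" "h m = h n" "m \<noteq> n"
      then have "m - n \<in> K" using split[OF y] by (auto simp: K_def)
      then obtain k where k: "m - n = q * k" using q by auto
      then have "q \<noteq> 0" using mn by auto
      have "m = n + k * q" using k by (simp add: algebra_simps)
      then have "m div q = n div q + k" using \<open>q \<noteq> 0\<close> by simp
      moreover have "(m div q) mod int p = (n div q) mod int p"
        using mn(3) \<open>p > 0\<close> by (simp add: h_def nat_eq_iff)
      ultimately have "int p dvd k"
        by (metis add_diff_cancel_left' mod_eq_dvd_iff)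
      then obtain c where "k = int p * c" by auto
      then have "m - n = int p * (q * c)" using k by simp
      moreover have "q * c \<in> K" using q by auto
      ultimately have "\<theta> * of_int (m - n) \<in> \<int>"
        by (simp add: K_def mult_ac)
      then show False using split[OF y mn(1,2,4)] by simp
    qed
    moreover have "h ` fiber g y \<subseteq> {..<p}"
      using \<open>p > 0\<close> by (auto simp: h_def nat_less_iff)
    ultimately have "h ` fiber g y = {..<p}"
      using card[OF y] by (intro card_subset_eq) (simp_all add: card_image)
    then have "0 \<in> h ` fiber g y" using \<open>p > 0\<close> by simp
    then obtain n where n: "n \<in> fiber g y" "h n = 0" by force
    have "\<exists>!n. n \<in> fiber g y \<and> h n = 0"
    proof (rule ex1I)
      fix m assume "m \<in> fiber g y \<and> h m = 0"
      then show "m = n"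
        using n inj_onD[OF \<open>inj_on h (fiber g y)\<close>, of m n] by simp
    qed (use n in simp)
    moreover have "h n = 0 \<longleftrightarrow> n \<in> N" for n
    proof -
      have "0 \<le> n div q mod int p" using \<open>p > 0\<close> by simp
      then show ?thesis by (auto simp: h_def N_def dvd_eq_mod_eq_0)
    qed
    ultimately show ?thesis by simp
  qed
  \<comment> \<open>The sign makes the translates that contain \<open>y\<close> correspond to the
    elements of \<open>N\<close> in the fibre over \<open>y\<close>; generic \<open>y\<close> have
    exactly one, and the others form a null set.\<close>
  define T where "T = (\<lambda>n. - of_int n / g) ` N"
  have mem: "y \<in> (\<lambda>x. x + - of_int n / g) ` \<Omega> \<longleftrightarrow> n \<in> fiber g y" for y n
  proof -
    have "y \<in> (\<lambda>x. x + c) ` \<Omega> \<longleftrightarrow> y - c \<in> \<Omega>" for c by force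
    from this[of "- of_int n / g"] show ?thesis by (simp add: fiber_def)
  qed
  have null: "S \<in> null_sets lebesgue" if "\<And>y. y \<in> S \<Longrightarrow> \<not> generic g y" for S
  proof (rule null_sets_completionI[OF countable_imp_null_set_lborel])
    show "countable S"
      by (rule countable_subset[OF _ countable_not_generic]) (use that in auto)
  qed
  have cover: "\<not> generic g y" if y: "y \<in> - (\<Union>t\<in>T. (\<lambda>x. x + t) ` \<Omega>)" for y
  proof
    assume "generic g y"
    then obtain n where n: "n \<in> fiber g y" "n \<in> N" using unique by blast
    have "y \<in> (\<lambda>x. x + - of_int n / g) ` \<Omega>" using n(1) mem by blast
    moreover have "- of_int n / g \<in> T" using n(2) unfolding T_def by (rule imageI)
    ultimately show False using y by blast
  qed
  have overlap: "\<not> generic g y"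
    if st: "s \<in> T" "t \<in> T" "s \<noteq> t" and y: "y \<in> (\<lambda>x. x + s) ` \<Omega> \<inter> (\<lambda>x. x + t) ` \<Omega>" for s t y
  proof
    assume gen: "generic g y"
    obtain m where m: "s = - of_int m / g" "m \<in> N" using st(1) unfolding T_def by (rule imageE)
    obtain n where n: "t = - of_int n / g" "n \<in> N" using st(2) unfolding T_def by (rule imageE)
    have "m \<in> fiber g y" "n \<in> fiber g y"
      using y mem[of y m] mem[of y n] unfolding m(1) n(1) by (blast, blast)
    then have "m = n" using unique[OF gen] m(2) n(2) by blast
    then show False using st(3) m(1) n(1) by simp
  qed
  show ?thesis
    unfolding tiles_by_translations_def
    using null[OF cover] null[OF overlap] by (intro exI[of _ T] conjI ballI impI)
qed

end

context coset_spectrum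
begin

text \<open>For two representatives \<open>x\<close>, \<open>z\<close> and
  \<open>\<theta> = (x - z) / g\<close>, orthogonality says that the \<open>card R\<close> numbers
  \<open>ee (\<theta> * n)\<close> over a fibre sum to 0. Two or three unit numbers with sum 0 are
  distinct and have equal \<open>card R\<close>-th powers; this fails for four.\<close>

lemma tiles_if_card_R_le_3:
  assumes "card R \<le> 3"
  shows "tiles_by_translations \<Omega>"
proof -
  have "card R > 0" using R_nonempty finite_R by (simp add: card_gt_0_iff)
  have "\<exists>\<theta>. \<forall>y m n. generic g y \<longrightarrow> m \<in> fiber g y \<longrightarrow> n \<in> fiber g y \<longrightarrow> m \<noteq> n \<longrightarrow>
      real (card R) * \<theta> * of_int (m - n) \<in> \<int> \<and> \<theta> * of_int (m - n) \<notin> \<int>"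
  proof (cases "card R = 1")
    case True
    \<comment> \<open>One-point fibres make the condition vacuous.\<close>
    then show ?thesis using card_fiber_eq_card_R by (metis card_1_singletonE singletonD)
  next
    case False
    then have "card R \<ge> 2" using \<open>card R > 0\<close> by simp
    then obtain x z where xz: "x \<in> R" "z \<in> R" "x \<noteq> z"
      by (metis card_le_Suc0_iff_eq finite_R not_less_eq_eq numeral_2_eq_2)
    define \<theta> where "\<theta> = (x - z) / g"
    have ee: "ee (real (card R) * (\<theta> * of_int m)) = ee (real (card R) * (\<theta> * of_int n)) \<and>
        ee (\<theta> * of_int m) \<noteq> ee (\<theta> * of_int n)"
      if y: "generic g y" and mn: "m \<in> fiber g y" "n \<in> fiber g y" "m \<noteq> n" for y m n
    proof -
      define F where "F = fiber g y"
      have F: "finite F" unfolding F_def by (rule finite_fiber[OF g_pos y])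
      have card: "card F = card R" using card_fiber_eq_card_R[OF y] by (simp add: F_def)
      have sum: "(\<Sum>n\<in>F. ee (\<theta> * of_int n)) = 0"
        unfolding F_def \<theta>_def by (rule fiber_orthogonal[OF y xz])
      have pow: "ee (real (card R) * t) = ee t ^ card R" for t
        by (rule ee_of_nat_mult)
      have mn': "{m, n} \<subseteq> F" using mn by (simp add: F_def)
      show ?thesis
      proof (cases "card R = 2")
        case True
        then have "F = {m, n}" using card mn' mn(3) F by (intro card_seteq[symmetric]) auto
        then have "ee (\<theta> * of_int m) = - ee (\<theta> * of_int n)"
          using sum mn(3) by (simp add: eq_neg_iff_add_eq_0)
        then show ?thesis
          using pow[of "\<theta> * of_int m"] pow[of "\<theta> * of_int n"] True by simp
      next
        case False
        then have 3: "card R = 3" using \<open>card R \<ge> 2\<close> assms by simp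
        then have "card (F - {m, n}) = 1" using card mn' mn(3) F by (subst card_Diff_subset) auto
        then obtain k where "F - {m, n} = {k}" by (auto simp: card_1_singleton_iff)
        then have "F = {m, n, k}" "k \<noteq> m" "k \<noteq> n" using mn' by auto
        then have "ee (\<theta> * of_int m) + ee (\<theta> * of_int n) + ee (\<theta> * of_int k) = 0"
          using sum mn(3) by (simp add: add_ac)
        then show ?thesis
          using three_unit_numbers_sum_0[of "ee (\<theta> * of_int m)" "ee (\<theta> * of_int n)"]
            pow[of "\<theta> * of_int m"] pow[of "\<theta> * of_int n"] 3 by simp
      qed
    qed
    have "real (card R) * \<theta> * of_int (m - n) \<in> \<int> \<and> \<theta> * of_int (m - n) \<notin> \<int>"
      if "generic g y" "m \<in> fiber g y" "n \<in> fiber g y" "m \<noteq> n" for y m n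
    proof -
      have "real (card R) * (\<theta> * of_int m) - real (card R) * (\<theta> * of_int n) \<in> \<int>"
        "\<theta> * of_int m - \<theta> * of_int n \<notin> \<int>"
        using ee[OF that]
        by (simp_all only: ee_eq_iff HOL.simp_thms)
      then show ?thesis unfolding of_int_diff right_diff_distrib mult.assoc by blast
    qed
    then show ?thesis by (intro exI[of _ \<theta>]) simp
  qed
  then obtain \<theta> where \<theta>: "\<And>y m n. generic g y \<Longrightarrow> m \<in> fiber g y \<Longrightarrow> n \<in> fiber g y \<Longrightarrow> m \<noteq> n \<Longrightarrow>
      real (card R) * \<theta> * of_int (m - n) \<in> \<int> \<and> \<theta> * of_int (m - n) \<notin> \<int>"
    by metis
  show ?thesis
    by (rule tiles_if_fibers_split[OF g_pos \<open>card R > 0\<close> card_fiber_eq_card_R \<theta>])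
qed

end

context spectral_intervals
begin

lemma coset_spectrumI:
  assumes "g > 0" "finite R" "\<Lambda> = {x + g * of_int k |x k::int. x \<in> R}"
    and "\<And>x y. x \<in> R \<Longrightarrow> y \<in> R \<Longrightarrow> x \<noteq> y \<Longrightarrow> (x - y) / g \<notin> \<int>"
  shows "coset_spectrum J l u \<Lambda> g R"
  using assms by unfold_locales auto

lemma tiles_if_few_cosets:
  assumes "g > 0" and G: "G = range (\<lambda>k::int. g * of_int k)"
    and R: "finite R" "card R \<le> 3" and \<Lambda>: "\<Lambda> = {x + h |x h. x \<in> R \<and> h \<in> G}"
    and distinct: "\<And>x y. x \<in> R \<Longrightarrow> y \<in> R \<Longrightarrow> x \<noteq> y \<Longrightarrow> x - y \<notin> G"
  shows "tiles_by_translations \<Omega>"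
proof -
  interpret coset_spectrum J l u \<Lambda> g R
  proof (rule coset_spectrumI)
    show "(x - y) / g \<notin> \<int>" if "x \<in> R" "y \<in> R" "x \<noteq> y" for x y
    proof
      assume "(x - y) / g \<in> \<int>"
      then obtain k where "(x - y) / g = of_int k" by (auto elim: Ints_cases)
      then have "x - y = g * of_int k" using \<open>g > 0\<close> by (simp add: field_simps)
      then show False using distinct[OF that] G by auto
    qed
  qed (use assms in auto)
  show ?thesis by (rule tiles_if_card_R_le_3[OF R(2)])
qed

end

section \<open>Endpoints in several classes modulo 1/d\<close>

text \<open>Conjugation gives equal sums of inverses. If the common sum is nonzero, the products
  agree as well, and the two pairs are the roots of the same quadratic.\<close>

lemma unit_pairs_equal_sum:
  fixes a b c d :: complex
  assumes "a + b = c + d" and n: "norm a = 1" "norm b = 1" "norm c = 1" "norm d = 1"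
  shows "a = c \<and> b = d \<or> a = d \<and> b = c \<or> a + b = 0"
proof (cases "a + b = 0")
  case False
  have nz: "a \<noteq> 0" "b \<noteq> 0" "c \<noteq> 0" "d \<noteq> 0" using n by auto
  have "inverse a + inverse b = inverse c + inverse d"
    using arg_cong[OF assms(1), of cnj] by (simp add: inverse_unit n)
  then have "(a + b) / (a * b) = (a + b) / (c * d)"
    unfolding assms(1)[symmetric] using nz assms(1) by (simp add: field_simps)
  then have "a * b = c * d" using False nz by simp
  moreover have "b = c + d - a" using assms(1) by (simp add: algebra_simps)
  ultimately have "(a - c) * (a - d) = 0" by (simp add: algebra_simps)
  then show ?thesis using \<open>b = c + d - a\<close> by auto
qed simp

text \<open>The multiplicities are complex numbers because they arise from \<open>weighted\<close>
  with an indicator for \<open>\<Phi>\<close>.\<close>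

lemma equal_counts_imp_permuted:
  fixes z\<^sub>1 z\<^sub>2 z\<^sub>3 w\<^sub>1 w\<^sub>2 w\<^sub>3 :: 'a
  assumes "\<And>v. (if w\<^sub>1 = v then 1 else 0 :: complex) + (if w\<^sub>2 = v then 1 else 0) + (if w\<^sub>3 = v then 1 else 0)
    = (if z\<^sub>1 = v then 1 else 0) + (if z\<^sub>2 = v then 1 else 0) + (if z\<^sub>3 = v then 1 else 0)"
  shows "z\<^sub>1 = w\<^sub>1 \<and> z\<^sub>2 = w\<^sub>2 \<and> z\<^sub>3 = w\<^sub>3 \<or> z\<^sub>1 = w\<^sub>2 \<and> z\<^sub>2 = w\<^sub>1 \<and> z\<^sub>3 = w\<^sub>3 \<or>
    z\<^sub>1 = w\<^sub>1 \<and> z\<^sub>2 = w\<^sub>3 \<and> z\<^sub>3 = w\<^sub>2 \<or> z\<^sub>1 = w\<^sub>2 \<and> z\<^sub>2 = w\<^sub>3 \<and> z\<^sub>3 = w\<^sub>1 \<or>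
    z\<^sub>1 = w\<^sub>3 \<and> z\<^sub>2 = w\<^sub>1 \<and> z\<^sub>3 = w\<^sub>2 \<or> z\<^sub>1 = w\<^sub>3 \<and> z\<^sub>2 = w\<^sub>2 \<and> z\<^sub>3 = w\<^sub>1"
  using assms[of z\<^sub>1] assms[of z\<^sub>2] assms[of z\<^sub>3] by (simp split: if_splits)

text \<open>The hypotheses of \<open>tiles_if_few_cosets\<close>, stated without
  \<open>\<Omega>\<close> so that they can be derived from the endpoint equations alone.\<close>

definition few_cosets :: "real set \<Rightarrow> bool" where
  "few_cosets \<Lambda> \<longleftrightarrow> (\<exists>g R. 0 < g \<and> finite R \<and> card R \<le> 3 \<and>
     \<Lambda> = {x + h |x h. x \<in> R \<and> h \<in> range (\<lambda>k::int. g * of_int k)} \<and>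
     (\<forall>x\<in>R. \<forall>y\<in>R. x \<noteq> y \<longrightarrow> x - y \<notin> range (\<lambda>k::int. g * of_int k)))"

lemma few_cosetsI:
  assumes "0 \<in> G" and "\<And>x z. x \<in> G \<Longrightarrow> z \<in> G \<Longrightarrow> x - z \<in> G"
    and "d \<in> G" "d \<noteq> 0" and "y \<noteq> 0" and "\<And>x. x \<in> G \<Longrightarrow> x * y \<in> \<int>"
    and "finite R" "card R \<le> 3" "\<Lambda> = {x + h |x h. x \<in> R \<and> h \<in> G}"
    and "\<And>x y. x \<in> R \<Longrightarrow> y \<in> R \<Longrightarrow> x \<noteq> y \<Longrightarrow> x - y \<notin> G"
  shows "few_cosets \<Lambda>"
proof -
  obtain g where "g > 0" "G = range (\<lambda>k::int. g * of_int k)"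
    using real_subgroup_cyclic[OF assms(1-6)] by blast
  then show ?thesis unfolding few_cosets_def using assms(7-10) by blast
qed

text \<open>Only the endpoint equations are kept, and \<open>l\<^sub>1\<close>,
  \<open>u\<^sub>1\<close> need not belong to one interval. Left and right endpoints can therefore
  be permuted independently, which the swap lemmas below provide.\<close>

locale spectral_triple =
  fixes l\<^sub>1 l\<^sub>2 l\<^sub>3 u\<^sub>1 u\<^sub>2 u\<^sub>3 d :: real and \<Lambda> :: "real set"
  assumes total: "u\<^sub>1 + u\<^sub>2 + u\<^sub>3 = l\<^sub>1 + l\<^sub>2 + l\<^sub>3 + 1"
    and orthogonal: "x \<in> \<Lambda> \<Longrightarrow> y \<in> \<Lambda> \<Longrightarrow>
      ee ((x - y) * u\<^sub>1) + ee ((x - y) * u\<^sub>2) + ee ((x - y) * u\<^sub>3)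
        = ee ((x - y) * l\<^sub>1) + ee ((x - y) * l\<^sub>2) + ee ((x - y) * l\<^sub>3)"
    and complete: "(\<And>y. y \<in> \<Lambda> \<Longrightarrow>
      ee ((x - y) * u\<^sub>1) + ee ((x - y) * u\<^sub>2) + ee ((x - y) * u\<^sub>3)
        = ee ((x - y) * l\<^sub>1) + ee ((x - y) * l\<^sub>2) + ee ((x - y) * l\<^sub>3)) \<Longrightarrow> x \<in> \<Lambda>"
    and d_pos: "d > 0" and d_multiples: "d * of_int k \<in> \<Lambda>"
begin

lemma swap_l12: "spectral_triple l\<^sub>2 l\<^sub>1 l\<^sub>3 u\<^sub>1 u\<^sub>2 u\<^sub>3 d \<Lambda>"
  by unfold_locales (use total orthogonal complete d_pos d_multiples in \<open>simp_all add: add_ac\<close>)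

lemma swap_l23: "spectral_triple l\<^sub>1 l\<^sub>3 l\<^sub>2 u\<^sub>1 u\<^sub>2 u\<^sub>3 d \<Lambda>"
  by unfold_locales (use total orthogonal complete d_pos d_multiples in \<open>simp_all add: add_ac\<close>)

lemma swap_u12: "spectral_triple l\<^sub>1 l\<^sub>2 l\<^sub>3 u\<^sub>2 u\<^sub>1 u\<^sub>3 d \<Lambda>"
  by unfold_locales (use total orthogonal complete d_pos d_multiples in \<open>simp_all add: add_ac\<close>)

lemma swap_u23: "spectral_triple l\<^sub>1 l\<^sub>2 l\<^sub>3 u\<^sub>1 u\<^sub>3 u\<^sub>2 d \<Lambda>"
  by unfold_locales (use total orthogonal complete d_pos d_multiples in \<open>simp_all add: add_ac\<close>)

lemma d_mem: "d \<in> \<Lambda>" and zero_mem: "0 \<in> \<Lambda>"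
  using d_multiples[of 1] d_multiples[of 0] by simp_all

text \<open>Orthogonality of \<open>x\<close> to the points \<open>- d * k\<close> of
  \<open>\<Lambda>\<close> gives equal power sums with nodes \<open>ee (d * t)\<close> and weights
  \<open>ee (x * t)\<close>, where \<open>t\<close> runs through the endpoints.\<close>

lemma weighted:
  assumes "x \<in> \<Lambda>"
  shows "ee (x * u\<^sub>1) * \<Phi> (ee (d * u\<^sub>1)) + ee (x * u\<^sub>2) * \<Phi> (ee (d * u\<^sub>2)) + ee (x * u\<^sub>3) * \<Phi> (ee (d * u\<^sub>3))
       = ee (x * l\<^sub>1) * \<Phi> (ee (d * l\<^sub>1)) + ee (x * l\<^sub>2) * \<Phi> (ee (d * l\<^sub>2)) + ee (x * l\<^sub>3) * \<Phi> (ee (d * l\<^sub>3))"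
proof -
  define sel where "sel a b c i = (if i = 0 then a else if i = 1 then b else c)" for a b c :: real and i :: nat
  have "(\<Sum>i<3. ee (x * sel u\<^sub>1 u\<^sub>2 u\<^sub>3 i) * \<Phi> (ee (d * sel u\<^sub>1 u\<^sub>2 u\<^sub>3 i)))
      = (\<Sum>i<3. ee (x * sel l\<^sub>1 l\<^sub>2 l\<^sub>3 i) * \<Phi> (ee (d * sel l\<^sub>1 l\<^sub>2 l\<^sub>3 i)))"
  proof (rule power_sums_eq_imp_weighted_sums_eq[
      where a = "\<lambda>i. ee (x * sel u\<^sub>1 u\<^sub>2 u\<^sub>3 i)" and z = "\<lambda>i. ee (d * sel u\<^sub>1 u\<^sub>2 u\<^sub>3 i)"
        and b = "\<lambda>i. ee (x * sel l\<^sub>1 l\<^sub>2 l\<^sub>3 i)" and w = "\<lambda>i. ee (d * sel l\<^sub>1 l\<^sub>2 l\<^sub>3 i)"])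
    fix k :: nat
    have "ee (x * t) * ee (d * t) ^ k = ee ((x - d * of_int (- int k)) * t)" for t
      by (simp add: ee_of_nat_mult[symmetric] ee_add[symmetric] algebra_simps)
    then show "(\<Sum>i<3. ee (x * sel u\<^sub>1 u\<^sub>2 u\<^sub>3 i) * ee (d * sel u\<^sub>1 u\<^sub>2 u\<^sub>3 i) ^ k)
        = (\<Sum>i<3. ee (x * sel l\<^sub>1 l\<^sub>2 l\<^sub>3 i) * ee (d * sel l\<^sub>1 l\<^sub>2 l\<^sub>3 i) ^ k)"
      using orthogonal[OF assms d_multiples[of "- int k"]]
      by (simp add: sel_def lessThan_Suc numeral_3_eq_3 add_ac)
  qed simp
  then show ?thesis by (simp add: sel_def lessThan_Suc numeral_3_eq_3 add_ac)
qed

text \<open>The frequencies satisfying the three equations form a group \<open>G\<close>, and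
  completeness puts all of \<open>G\<close> into \<open>\<Lambda>\<close>. By \<open>total\<close>
  some \<open>l\<close> differs from its partner \<open>u\<close>, and this difference makes
  \<open>G\<close> discrete.\<close>

lemma few_cosets_if_matched:
  assumes "\<And>x. x \<in> \<Lambda> \<Longrightarrow> ee (x * l\<^sub>1) = ee (x * u\<^sub>1) \<and> ee (x * l\<^sub>2) = ee (x * u\<^sub>2) \<and> ee (x * l\<^sub>3) = ee (x * u\<^sub>3)"
  shows "few_cosets \<Lambda>"
proof -
  define G where "G = {x. ee (x * l\<^sub>1) = ee (x * u\<^sub>1) \<and> ee (x * l\<^sub>2) = ee (x * u\<^sub>2) \<and> ee (x * l\<^sub>3) = ee (x * u\<^sub>3)}"
  have "\<Lambda> \<subseteq> G" unfolding G_def using assms by blast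
  moreover have "x \<in> \<Lambda>" if "x \<in> G" for x
  proof (rule complete)
    fix y assume "y \<in> \<Lambda>"
    then show "ee ((x - y) * u\<^sub>1) + ee ((x - y) * u\<^sub>2) + ee ((x - y) * u\<^sub>3)
        = ee ((x - y) * l\<^sub>1) + ee ((x - y) * l\<^sub>2) + ee ((x - y) * l\<^sub>3)"
      using that assms[of y] by (simp add: G_def ee_left_diff)
  qed
  ultimately have G: "\<Lambda> = G" by blast
  have "\<exists>y. y \<noteq> 0 \<and> (\<forall>x\<in>G. x * y \<in> \<int>)"
  proof -
    have int: "\<forall>x\<in>G. x * (l\<^sub>1 - u\<^sub>1) \<in> \<int>" "\<forall>x\<in>G. x * (l\<^sub>2 - u\<^sub>2) \<in> \<int>" "\<forall>x\<in>G. x * (l\<^sub>3 - u\<^sub>3) \<in> \<int>"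
      by (auto simp: G_def ee_eq_iff right_diff_distrib)
    have "l\<^sub>1 - u\<^sub>1 \<noteq> 0 \<or> l\<^sub>2 - u\<^sub>2 \<noteq> 0 \<or> l\<^sub>3 - u\<^sub>3 \<noteq> 0" using total by linarith
    then show ?thesis using int by blast
  qed
  then obtain y where "y \<noteq> 0" "\<And>x. x \<in> G \<Longrightarrow> x * y \<in> \<int>" by blast
  then show ?thesis
    using d_mem d_pos
    by (intro few_cosetsI[where G = G and d = d and y = y and R = "{0}"])
      (simp_all add: G, simp_all add: G_def ee_left_diff)
qed

text \<open>Each class modulo 1/d contains one endpoint of either kind, so the indicator of the
  class isolates a single matching equation.\<close>

lemma few_cosets_if_distinct:
  assumes "ee (d * l\<^sub>1) = ee (d * u\<^sub>1)" "ee (d * l\<^sub>2) = ee (d * u\<^sub>2)" "ee (d * l\<^sub>3) = ee (d * u\<^sub>3)"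
    and "ee (d * l\<^sub>1) \<noteq> ee (d * l\<^sub>2)" "ee (d * l\<^sub>1) \<noteq> ee (d * l\<^sub>3)" "ee (d * l\<^sub>2) \<noteq> ee (d * l\<^sub>3)"
  shows "few_cosets \<Lambda>"
proof (rule few_cosets_if_matched)
  fix x assume "x \<in> \<Lambda>"
  note weighted[OF this, of "\<lambda>z. if z = v then 1 else 0" for v]
  from this[of "ee (d * l\<^sub>1)"] this[of "ee (d * l\<^sub>2)"] this[of "ee (d * l\<^sub>3)"]
  show "ee (x * l\<^sub>1) = ee (x * u\<^sub>1) \<and> ee (x * l\<^sub>2) = ee (x * u\<^sub>2) \<and> ee (x * l\<^sub>3) = ee (x * u\<^sub>3)"
    using assms(4-6) assms(4-6)[symmetric] by (simp add: assms(1-3)[symmetric])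
qed

text \<open>One strictly matched \<open>x\<close> fixes the matching for every \<open>y\<close>.
  Conjugating \<open>second\<close> at \<open>y\<close> shows that the inverses at
  \<open>l\<^sub>2\<close> and \<open>l\<^sub>3\<close> deviate from those at
  \<open>u\<^sub>2\<close> and \<open>u\<^sub>3\<close> by opposite amounts. In the orthogonality of
  \<open>x\<close> and \<open>y\<close> the deviation is multiplied by the difference of two
  distinct values at \<open>x\<close>, so it is 0.\<close>

lemma few_cosets_if_strictly_matched_pair:
  assumes first: "\<And>x. x \<in> \<Lambda> \<Longrightarrow> ee (x * l\<^sub>1) = ee (x * u\<^sub>1)"
    and second: "\<And>x. x \<in> \<Lambda> \<Longrightarrow> ee (x * l\<^sub>2) + ee (x * l\<^sub>3) = ee (x * u\<^sub>2) + ee (x * u\<^sub>3)"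
    and x: "x \<in> \<Lambda>" "ee (x * l\<^sub>2) = ee (x * u\<^sub>2)" "ee (x * l\<^sub>3) = ee (x * u\<^sub>3)" "ee (x * l\<^sub>2) \<noteq> ee (x * l\<^sub>3)"
  shows "few_cosets \<Lambda>"
proof (rule few_cosets_if_matched)
  fix y assume y: "y \<in> \<Lambda>"
  define a where "a = inverse (ee (y * l\<^sub>2)) - inverse (ee (y * u\<^sub>2))"
  have "ee (x * l\<^sub>2) / ee (y * l\<^sub>2) + ee (x * l\<^sub>3) / ee (y * l\<^sub>3)
      = ee (x * l\<^sub>2) / ee (y * u\<^sub>2) + ee (x * l\<^sub>3) / ee (y * u\<^sub>3)"
    using orthogonal[OF x(1) y] first[OF x(1)] first[OF y] x(2,3) by (simp add: ee_left_diff)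
  moreover have "inverse (ee (y * l\<^sub>2)) + inverse (ee (y * l\<^sub>3)) = inverse (ee (y * u\<^sub>2)) + inverse (ee (y * u\<^sub>3))"
    using arg_cong[OF second[OF y], of cnj] by (simp add: inverse_unit)
  then have "inverse (ee (y * l\<^sub>3)) - inverse (ee (y * u\<^sub>3)) = - a"
    by (simp add: a_def algebra_simps)
  moreover have "X * p + Y * q = X * r + Y * s \<Longrightarrow> q - s = - (p - r) \<Longrightarrow> (X - Y) * (p - r) = 0"
    for X Y p q r s :: complex
    by algebra
  ultimately have "(ee (x * l\<^sub>2) - ee (x * l\<^sub>3)) * a = 0"
    unfolding a_def divide_inverse by blast
  then have "ee (y * l\<^sub>2) = ee (y * u\<^sub>2)" using x(4) by (simp add: a_def)
  then show "ee (y * l\<^sub>1) = ee (y * u\<^sub>1) \<and> ee (y * l\<^sub>2) = ee (y * u\<^sub>2) \<and> ee (y * l\<^sub>3) = ee (y * u\<^sub>3)"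
    using first[OF y] second[OF y] by simp
qed

text \<open>The first class gives a matched pair, the second an equality of two sums of two unit
  numbers. Such sums either match termwise or vanish. A strict match is settled by the previous
  lemma; otherwise \<open>\<Lambda>\<close> is a group \<open>G\<close> or two cosets of it.\<close>

lemma few_cosets_if_paired:
  assumes "ee (d * l\<^sub>1) = ee (d * u\<^sub>1)" "ee (d * l\<^sub>2) = ee (d * u\<^sub>2)" "ee (d * l\<^sub>3) = ee (d * u\<^sub>3)"
    and "ee (d * l\<^sub>1) \<noteq> ee (d * l\<^sub>2)" "ee (d * l\<^sub>2) = ee (d * l\<^sub>3)"
  shows "few_cosets \<Lambda>"
proof -
  have both: "ee (x * l\<^sub>1) = ee (x * u\<^sub>1)" "ee (x * l\<^sub>2) + ee (x * l\<^sub>3) = ee (x * u\<^sub>2) + ee (x * u\<^sub>3)" if "x \<in> \<Lambda>" for x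
    using weighted[OF that, of "\<lambda>z. if z = ee (d * l\<^sub>1) then 1 else 0"]
      weighted[OF that, of "\<lambda>z. if z = ee (d * l\<^sub>2) then 1 else 0"] assms
    by (auto split: if_splits)
  show ?thesis
  proof (cases "\<exists>x\<in>\<Lambda>. ee (x * l\<^sub>2) \<noteq> ee (x * l\<^sub>3) \<and>
      (ee (x * l\<^sub>2) = ee (x * u\<^sub>2) \<and> ee (x * l\<^sub>3) = ee (x * u\<^sub>3) \<or>
       ee (x * l\<^sub>2) = ee (x * u\<^sub>3) \<and> ee (x * l\<^sub>3) = ee (x * u\<^sub>2))")
    case True
    then show ?thesis
      using few_cosets_if_strictly_matched_pair[OF both]
        spectral_triple.few_cosets_if_strictly_matched_pair[OF swap_u23] both
      by (metis add.commute)
  next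
    case False
    define G where "G = {x. ee (x * l\<^sub>1) = ee (x * u\<^sub>1) \<and> ee (x * l\<^sub>2) = ee (x * l\<^sub>3) \<and>
      ee (x * u\<^sub>2) = ee (x * l\<^sub>3) \<and> ee (x * u\<^sub>3) = ee (x * l\<^sub>3)}"
    have opposite: "ee (x * l\<^sub>2) = - ee (x * l\<^sub>3)" "ee (x * u\<^sub>2) = - ee (x * u\<^sub>3)" if "x \<in> \<Lambda>" "x \<notin> G" for x
    proof -
      have "ee (x * l\<^sub>2) + ee (x * l\<^sub>3) = 0"
        using unit_pairs_equal_sum[OF both(2)[OF that(1)]] both(1)[OF that(1)] False that
        by (auto simp: G_def)
      then show "ee (x * l\<^sub>2) = - ee (x * l\<^sub>3)" "ee (x * u\<^sub>2) = - ee (x * u\<^sub>3)"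
        using both(2)[OF that(1)] by (simp_all add: eq_neg_iff_add_eq_0)
    qed
    \<comment> \<open>Adding \<open>z \<in> G\<close> multiplies the first pair of terms by one
      phase and the other four terms by another, and both groups balance separately.\<close>
    have add: "x + z \<in> \<Lambda>" if "x \<in> \<Lambda>" "z \<in> G" for x z
    proof (rule complete)
      fix y assume y: "y \<in> \<Lambda>"
      have eq: "ee ((x + z - y) * t) = ee (z * t) * ee ((x - y) * t)" for t
        by (simp add: ee_add[symmetric] algebra_simps)
      have 1: "ee ((x - y) * l\<^sub>1) = ee ((x - y) * u\<^sub>1)"
        using both(1)[OF that(1)] both(1)[OF y] by (simp add: ee_left_diff)
      then have "ee ((x - y) * u\<^sub>2) + ee ((x - y) * u\<^sub>3) = ee ((x - y) * l\<^sub>2) + ee ((x - y) * l\<^sub>3)"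
        using orthogonal[OF that(1) y] by simp
      then have "ee (z * l\<^sub>3) * ee ((x - y) * u\<^sub>2) + ee (z * l\<^sub>3) * ee ((x - y) * u\<^sub>3)
          = ee (z * l\<^sub>3) * ee ((x - y) * l\<^sub>2) + ee (z * l\<^sub>3) * ee ((x - y) * l\<^sub>3)"
        by (simp only: distrib_left[symmetric])
      then show "ee ((x + z - y) * u\<^sub>1) + ee ((x + z - y) * u\<^sub>2) + ee ((x + z - y) * u\<^sub>3)
          = ee ((x + z - y) * l\<^sub>1) + ee ((x + z - y) * l\<^sub>2) + ee ((x + z - y) * l\<^sub>3)"
        unfolding eq using that(2) 1 by (simp add: G_def add.assoc)
    qed
    \<comment> \<open>Signs cancel in the difference: within each pair the values at
      \<open>x - z\<close> coincide, so the balance equation says that twice one value equals twice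
      the other.\<close>
    have diff: "x - z \<in> G" if "x \<in> \<Lambda>" "x \<notin> G" "z \<in> \<Lambda>" "z \<notin> G" for x z
    proof -
      have "ee ((x - z) * u\<^sub>2) + ee ((x - z) * u\<^sub>3) = ee ((x - z) * l\<^sub>2) + ee ((x - z) * l\<^sub>3)"
        using orthogonal[OF that(1,3)] both(1)[OF that(1)] both(1)[OF that(3)] by (simp add: ee_left_diff)
      moreover have "ee ((x - z) * u\<^sub>2) = ee ((x - z) * u\<^sub>3)" "ee ((x - z) * l\<^sub>2) = ee ((x - z) * l\<^sub>3)"
        "ee ((x - z) * l\<^sub>1) = ee ((x - z) * u\<^sub>1)"
        using both(1)[OF that(1)] both(1)[OF that(3)] opposite[OF that(1,2)] opposite[OF that(3,4)]
        by (simp_all add: ee_left_diff)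
      ultimately show ?thesis by (simp add: G_def mult_2[symmetric])
    qed
    have G_sub: "G \<subseteq> \<Lambda>" using add[OF zero_mem] by auto
    have "\<exists>y. y \<noteq> 0 \<and> (\<forall>x\<in>G. x * y \<in> \<int>)"
    proof -
      have int: "\<forall>x\<in>G. x * (l\<^sub>1 - u\<^sub>1) \<in> \<int>" "\<forall>x\<in>G. x * (l\<^sub>2 - l\<^sub>3) \<in> \<int>" "\<forall>x\<in>G. x * (u\<^sub>2 - l\<^sub>3) \<in> \<int>"
        "\<forall>x\<in>G. x * (u\<^sub>3 - l\<^sub>3) \<in> \<int>"
        by (auto simp: G_def ee_eq_iff right_diff_distrib)
      \<comment> \<open>If all four differences vanished, \<open>total\<close> would read 0 =
        1.\<close>
      have "l\<^sub>1 - u\<^sub>1 \<noteq> 0 \<or> l\<^sub>2 - l\<^sub>3 \<noteq> 0 \<or> u\<^sub>2 - l\<^sub>3 \<noteq> 0 \<or> u\<^sub>3 - l\<^sub>3 \<noteq> 0" using total by linarith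
      then show ?thesis using int by blast
    qed
    then obtain y where y: "y \<noteq> 0" "\<And>x. x \<in> G \<Longrightarrow> x * y \<in> \<int>" by blast
    have "0 \<in> G" by (simp add: G_def)
    have G_diff: "x - z \<in> G" if "x \<in> G" "z \<in> G" for x z
      using that by (simp add: G_def ee_left_diff)
    have "d \<in> G" using assms by (simp add: G_def)
    note cosets = few_cosetsI[OF \<open>0 \<in> G\<close> G_diff \<open>d \<in> G\<close> _ y]
    show ?thesis
    proof (cases "\<Lambda> = G")
      case True
      then show ?thesis using d_pos by (intro cosets[where R = "{0}"]) auto
    next
      case False
      then obtain h where h: "h \<in> \<Lambda>" "h \<notin> G" using G_sub by blast
      have "- h \<notin> G" using G_diff[OF \<open>0 \<in> G\<close>, of "- h"] h by auto
      have "x \<in> {x + z |x z. x \<in> {0, h} \<and> z \<in> G}" if "x \<in> \<Lambda>" for x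
      proof (cases "x \<in> G")
        case False
        then have "x = h + (x - h)" "x - h \<in> G" using diff[OF that _ h] by auto
        then show ?thesis by blast
      qed force
      moreover have "{x + z |x z. x \<in> {0, h} \<and> z \<in> G} \<subseteq> \<Lambda>"
        using G_sub add[OF h(1)] by auto
      ultimately have "\<Lambda> = {x + z |x z. x \<in> {0, h} \<and> z \<in> G}" by blast
      then show ?thesis
        using d_pos h \<open>- h \<notin> G\<close> by (intro cosets[where R = "{0, h}"]) (auto simp: card_insert_if)
    qed
  qed
qed

text \<open>Indicators in \<open>weighted\<close> at \<open>x = 0\<close> show that left and right
  endpoints meet every class modulo 1/d equally often. After permuting the right endpoints the
  classes match, and there are three of them or two.\<close>

lemma few_cosets_if_not_all_ones:
  assumes "\<not> (ee (d * l\<^sub>1) = ee (d * l\<^sub>2) \<and> ee (d * l\<^sub>2) = ee (d * l\<^sub>3) \<and>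
    ee (d * u\<^sub>1) = ee (d * l\<^sub>1) \<and> ee (d * u\<^sub>2) = ee (d * l\<^sub>1) \<and> ee (d * u\<^sub>3) = ee (d * l\<^sub>1))"
  shows "few_cosets \<Lambda>"
proof -
  have "(if ee (d * u\<^sub>1) = v then 1 else 0 :: complex) + (if ee (d * u\<^sub>2) = v then 1 else 0) + (if ee (d * u\<^sub>3) = v then 1 else 0)
      = (if ee (d * l\<^sub>1) = v then 1 else 0) + (if ee (d * l\<^sub>2) = v then 1 else 0) + (if ee (d * l\<^sub>3) = v then 1 else 0)" for v
    using weighted[OF zero_mem, of "\<lambda>z. if z = v then 1 else 0"] by simp
  from equal_counts_imp_permuted[OF this]
  \<comment> \<open>The set equation at the end transfers the assumption of several classes to the
    permuted endpoints.\<close>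
  have "\<exists>v\<^sub>1 v\<^sub>2 v\<^sub>3. spectral_triple l\<^sub>1 l\<^sub>2 l\<^sub>3 v\<^sub>1 v\<^sub>2 v\<^sub>3 d \<Lambda> \<and>
      ee (d * l\<^sub>1) = ee (d * v\<^sub>1) \<and> ee (d * l\<^sub>2) = ee (d * v\<^sub>2) \<and> ee (d * l\<^sub>3) = ee (d * v\<^sub>3) \<and> {v\<^sub>1, v\<^sub>2, v\<^sub>3} = {u\<^sub>1, u\<^sub>2, u\<^sub>3}"
    using spectral_triple_axioms swap_u12 swap_u23 spectral_triple.swap_u12[OF swap_u23]
      spectral_triple.swap_u23[OF swap_u12] spectral_triple.swap_u12[OF spectral_triple.swap_u23[OF swap_u12]]
    by (elim disjE) (rule exI, rule exI, rule exI, rule conjI, assumption, force)+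
  then obtain v\<^sub>1 v\<^sub>2 v\<^sub>3 where v: "spectral_triple l\<^sub>1 l\<^sub>2 l\<^sub>3 v\<^sub>1 v\<^sub>2 v\<^sub>3 d \<Lambda>"
    "ee (d * l\<^sub>1) = ee (d * v\<^sub>1)" "ee (d * l\<^sub>2) = ee (d * v\<^sub>2)" "ee (d * l\<^sub>3) = ee (d * v\<^sub>3)"
    "{v\<^sub>1, v\<^sub>2, v\<^sub>3} = {u\<^sub>1, u\<^sub>2, u\<^sub>3}" by blast
  interpret v: spectral_triple l\<^sub>1 l\<^sub>2 l\<^sub>3 v\<^sub>1 v\<^sub>2 v\<^sub>3 d \<Lambda> by (rule v)
  have "\<not> (ee (d * l\<^sub>1) = ee (d * l\<^sub>2) \<and> ee (d * l\<^sub>2) = ee (d * l\<^sub>3))"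
    using assms v(2-5) by (metis insertI1 insertI2 insertE singletonD)
  then consider "ee (d * l\<^sub>1) \<noteq> ee (d * l\<^sub>2)" "ee (d * l\<^sub>1) \<noteq> ee (d * l\<^sub>3)" "ee (d * l\<^sub>2) \<noteq> ee (d * l\<^sub>3)"
    | "ee (d * l\<^sub>1) \<noteq> ee (d * l\<^sub>2)" "ee (d * l\<^sub>2) = ee (d * l\<^sub>3)"
    | "ee (d * l\<^sub>2) \<noteq> ee (d * l\<^sub>1)" "ee (d * l\<^sub>1) = ee (d * l\<^sub>3)"
    | "ee (d * l\<^sub>3) \<noteq> ee (d * l\<^sub>1)" "ee (d * l\<^sub>2) = ee (d * l\<^sub>1)"
    by metis
  then show ?thesis
  proof cases
    case 1
    then show ?thesis using v.few_cosets_if_distinct v(2-4) by blast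
  next
    case 2
    then show ?thesis using v.few_cosets_if_paired v(2-4) by blast
  next
    case 3
    interpret w: spectral_triple l\<^sub>2 l\<^sub>1 l\<^sub>3 v\<^sub>2 v\<^sub>1 v\<^sub>3 d \<Lambda>
      by (rule spectral_triple.swap_u12[OF v.swap_l12])
    show ?thesis using w.few_cosets_if_paired v(2-4) 3 by blast
  next
    case 4
    interpret w: spectral_triple l\<^sub>1 l\<^sub>3 l\<^sub>2 v\<^sub>1 v\<^sub>3 v\<^sub>2 d \<Lambda>
      by (rule spectral_triple.swap_u23[OF v.swap_l23])
    interpret w': spectral_triple l\<^sub>3 l\<^sub>1 l\<^sub>2 v\<^sub>3 v\<^sub>1 v\<^sub>2 d \<Lambda>
      by (rule spectral_triple.swap_u12[OF w.swap_l12])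
    show ?thesis using w'.few_cosets_if_paired v(2-4) 4 by simp
  qed
qed

end

section \<open>Endpoints in one class modulo 1/d\<close>

text \<open>For \<open>z\<close> on the circle, the condition that its image is on the circle
  becomes, after multiplication by \<open>z\<close>, a quadratic equation with leading coefficient
  \<open>c = \<alpha> * cnj \<beta>\<close>. Three distinct roots force
  \<open>c = 0\<close>.\<close>

lemma affine_unit_circle:
  fixes \<alpha> \<beta> :: complex
  assumes z: "norm z\<^sub>1 = 1" "norm z\<^sub>2 = 1" "norm z\<^sub>3 = 1" and "z\<^sub>1 \<noteq> z\<^sub>2" "z\<^sub>1 \<noteq> z\<^sub>3" "z\<^sub>2 \<noteq> z\<^sub>3"
    and w: "norm (\<alpha> * z\<^sub>1 + \<beta>) = 1" "norm (\<alpha> * z\<^sub>2 + \<beta>) = 1" "norm (\<alpha> * z\<^sub>3 + \<beta>) = 1"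
  shows "\<alpha> = 0 \<or> \<beta> = 0"
proof -
  define c where "c = \<alpha> * cnj \<beta>"
  define k where "k = 1 - \<alpha> * cnj \<alpha> - \<beta> * cnj \<beta>"
  have quad: "c * z\<^sup>2 - k * z + cnj c = 0" if "norm z = 1" "norm (\<alpha> * z + \<beta>) = 1" for z
  proof -
    have zz: "z * cnj z = 1" using that(1) by (simp add: complex_norm_square[symmetric])
    have "(\<alpha> * z + \<beta>) * cnj (\<alpha> * z + \<beta>) = 1"
      using that(2) by (simp only: complex_norm_square[symmetric]) simp
    then have "\<alpha> * cnj \<alpha> * (z * cnj z) + c * z + cnj c * cnj z + \<beta> * cnj \<beta> = 1"
      by (simp add: c_def algebra_simps)
    then have "c * z + cnj c * cnj z = k" unfolding zz k_def by algebra
    moreover have "c * z\<^sup>2 - k * z + cnj c = (c * z + cnj c * cnj z - k) * z + cnj c * (1 - z * cnj z)"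
      by (simp add: power2_eq_square algebra_simps)
    ultimately show ?thesis using zz by simp
  qed
  have "(z\<^sub>1 - z\<^sub>2) * (c * (z\<^sub>1 + z\<^sub>2) - k) = 0"
    using quad[OF z(1) w(1)] quad[OF z(2) w(2)] by algebra
  then have "c * (z\<^sub>1 + z\<^sub>2) = k" using assms(4) by simp
  moreover have "(z\<^sub>1 - z\<^sub>3) * (c * (z\<^sub>1 + z\<^sub>3) - k) = 0"
    using quad[OF z(1) w(1)] quad[OF z(3) w(3)] by algebra
  then have "c * (z\<^sub>1 + z\<^sub>3) = k" using assms(5) by simp
  ultimately have "c * z\<^sub>2 = c * z\<^sub>3" by (metis add_left_cancel distrib_left)
  then show ?thesis using assms(6) by (auto simp: c_def)
qed

section \<open>Linear relations between the values of exponentials at the endpoints\<close>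

context spectral_intervals
begin

definition endpoints :: "real set" where
  "endpoints = l ` J \<union> u ` J"

lemma D_lincomb:
  assumes "\<And>y. y \<in> endpoints \<Longrightarrow> ee (x * y) = \<alpha> * ee (x\<^sub>1 * y) + \<beta> * ee (x\<^sub>2 * y)" "D x\<^sub>1" "D x\<^sub>2"
  shows "D x"
proof -
  have "(\<Sum>j\<in>J. ee (x * f j)) = \<alpha> * (\<Sum>j\<in>J. ee (x\<^sub>1 * f j)) + \<beta> * (\<Sum>j\<in>J. ee (x\<^sub>2 * f j))"
    if "f = l \<or> f = u" for f
    unfolding sum_distrib_left sum.distrib[symmetric]
    using assms(1) that by (intro sum.cong) (auto simp: endpoints_def)
  then show ?thesis using assms(2,3) by (simp add: D_def)
qed

text \<open>\<open>D\<close> is linear in the vector of endpoint values, and so is orthogonality to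
  a fixed \<open>z\<close> after division by \<open>ee (z * y)\<close>. By maximality, linear
  relations thus produce new points of \<open>\<Lambda>\<close>.\<close>

lemma mem_lincomb:
  assumes "\<And>y. y \<in> endpoints \<Longrightarrow> ee (x * y) = \<alpha> * ee (x\<^sub>1 * y) + \<beta> * ee (x\<^sub>2 * y)" "x\<^sub>1 \<in> \<Lambda>" "x\<^sub>2 \<in> \<Lambda>"
  shows "x \<in> \<Lambda>"
proof (rule maximal)
  fix z assume z: "z \<in> \<Lambda>"
  show "D (x - z)"
    using D_diff[OF assms(2) z] D_diff[OF assms(3) z]
    by (rule D_lincomb[where \<alpha> = \<alpha> and \<beta> = \<beta>, rotated])
      (simp add: ee_left_diff assms(1) add_divide_distrib)
qed

text \<open>The size of a generic fibre is \<open>g\<close>. Integrality makes generators comparable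
  with \<open>d\<close>, which is minimal among integers only.\<close>

lemma g_natural:
  assumes "g > 0" "\<And>k::int. D (g * of_int k)"
  obtains n :: nat where "g = real n" "n > 0"
proof -
  obtain y where "generic g y" using exists_generic by blast
  then have "real (card (fiber g y)) = g"
    using assms(2)[of "int _"] by (intro card_fiber assms(1)) auto
  then show thesis using that[of "card (fiber g y)"] assms(1) by simp
qed

text \<open>The hypothesis \<open>two_dim\<close> says that \<open>dim V(\<Lambda> - d \<int>) \<le> 2\<close>.\<close>

lemma tiles_if_endpoints_in_lattice:
  fixes d :: nat
  assumes endpoints: "0 \<in> endpoints" "y\<^sub>1 \<in> endpoints" "y\<^sub>2 \<in> endpoints" "y\<^sub>1 \<noteq> 0" "y\<^sub>2 \<noteq> 0" "y\<^sub>1 \<noteq> y\<^sub>2"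
    and zero: "0 \<in> \<Lambda>" and d: "d > 0" "\<And>y. y \<in> endpoints \<Longrightarrow> ee (real d * y) = 1"
    and minimal: "\<And>m. m > 0 \<Longrightarrow> int_multiples m \<subseteq> \<Lambda> \<Longrightarrow> d \<le> m"
    and two_dim: "\<And>x\<^sub>1 x\<^sub>2 x y. x\<^sub>1 \<in> \<Lambda> - int_multiples d \<Longrightarrow> x\<^sub>2 \<in> \<Lambda> - int_multiples d \<Longrightarrow>
      x \<in> \<Lambda> - int_multiples d \<Longrightarrow> y \<in> endpoints \<Longrightarrow> ee (x\<^sub>1 * y) \<noteq> ee (x\<^sub>2 * y) \<Longrightarrow>
      \<exists>\<alpha> \<beta>. \<forall>y\<in>endpoints. ee (x * y) = \<alpha> * ee (x\<^sub>1 * y) + \<beta> * ee (x\<^sub>2 * y)"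
  shows "tiles_by_translations \<Omega>"
proof -
  define G where "G = {x. \<forall>y\<in>endpoints. ee (x * y) = 1}"
  have G_0: "0 \<in> G" by (simp add: G_def)
  have G_diff: "x - z \<in> G" if "x \<in> G" "z \<in> G" for x z
    using that by (simp add: G_def ee_left_diff)
  have d_G: "real d \<in> G" using d by (simp add: G_def)
  have add_G: "x + z \<in> \<Lambda>" if "x \<in> \<Lambda>" "z \<in> G" for x z
    by (rule mem_lincomb[where \<alpha> = 1 and \<beta> = 0 and x\<^sub>1 = x and x\<^sub>2 = x])
      (use that in \<open>auto simp: G_def ee_left_add\<close>)
  have G_sub: "G \<subseteq> \<Lambda>" using add_G[OF zero] by auto
  have "x * y\<^sub>1 \<in> \<int>" if "x \<in> G" for x
    using that endpoints by (simp add: G_def ee_eq_1_iff)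
  then obtain g where g: "g > 0" "G = range (\<lambda>k::int. g * of_int k)"
    using real_subgroup_cyclic[OF G_0 G_diff d_G _ endpoints(4)] d by auto
  \<comment> \<open>The generator of \<open>G\<close> is an integer \<open>n\<close> with
    \<open>d \<le> n\<close> by minimality, and \<open>n\<close> divides \<open>d\<close> because
    \<open>d \<in> G\<close>. So \<open>G\<close> consists of the multiples of
    \<open>d\<close>.\<close>
  have "D (g * of_int k)" for k
    using D_diff[of "g * of_int k" 0] G_sub g zero by auto
  then obtain n where n: "g = real n" "n > 0" using g_natural[OF g(1)] by blast
  have "int_multiples n \<subseteq> \<Lambda>" using G_sub g n by (simp add: int_multiples_def)
  then have "d \<le> n" using minimal n by blast
  obtain k :: int where k: "real d = g * of_int k" using d_G g by auto
  then have "int d = int n * k" using n by (metis of_int_mult of_int_of_nat_eq of_int_eq_iff)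
  then have "k > 0" using d n by (metis of_nat_0_less_iff zero_less_mult_pos)
  then have "int n * 1 \<le> int n * k" by (intro mult_left_mono) auto
  then have "n = d" using \<open>int d = int n * k\<close> \<open>d \<le> n\<close> by simp
  then have G: "G = range (\<lambda>k::int. real d * of_int k)" "G = int_multiples d"
    using g n by (simp_all add: int_multiples_def)
  have d_pos: "real d > 0" using d by simp
  note tilesI = tiles_if_few_cosets[OF d_pos G(1)]
  note two_dim' = two_dim[folded G(2)]
  have minus: "z - x \<notin> G" if "x - z \<notin> G" for x z
    using G_diff[OF G_0, of "z - x"] that by auto
  show ?thesis
  proof (cases "\<exists>x\<^sub>1 x\<^sub>2. x\<^sub>1 \<in> \<Lambda> - G \<and> x\<^sub>2 \<in> \<Lambda> - G \<and> x\<^sub>1 - x\<^sub>2 \<notin> G")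
    case False
    show ?thesis
    proof (cases "\<Lambda> = G")
      case True
      then show ?thesis by (intro tilesI[of "{0}"]) auto
    next
      case neq: False
      then obtain h where h: "h \<in> \<Lambda>" "h \<notin> G" using G_sub by blast
      have "x \<in> {x + z |x z. x \<in> {0, h} \<and> z \<in> G}" if "x \<in> \<Lambda>" for x
      proof (cases "x \<in> G")
        case notin: False
        then have "x = h + (x - h)" "x - h \<in> G" using False h that by auto
        then show ?thesis by blast
      qed force
      moreover have "{x + z |x z. x \<in> {0, h} \<and> z \<in> G} \<subseteq> \<Lambda>"
        using G_sub add_G[OF h(1)] by auto
      ultimately have "\<Lambda> = {x + z |x z. x \<in> {0, h} \<and> z \<in> G}" by blast
      then show ?thesis
        using h minus[of h 0] by (intro tilesI[of "{0, h}"]) (auto simp: card_insert_if)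
    qed
  next
    case True
    then obtain x\<^sub>1 x\<^sub>2 where x: "x\<^sub>1 \<in> \<Lambda> - G" "x\<^sub>2 \<in> \<Lambda> - G" "x\<^sub>1 - x\<^sub>2 \<notin> G" by blast
    define \<delta> where "\<delta> = x\<^sub>1 - x\<^sub>2"
    obtain y\<^sub>0 where y0: "y\<^sub>0 \<in> endpoints" "ee (\<delta> * y\<^sub>0) \<noteq> 1"
      using x by (auto simp: G_def \<delta>_def)
    then have "ee (x\<^sub>1 * y\<^sub>0) \<noteq> ee (x\<^sub>2 * y\<^sub>0)" by (simp add: \<delta>_def ee_left_diff)
    note lin = two_dim'[OF x(1,2) _ y0(1) this]
    \<comment> \<open>Division by \<open>ee (x\<^sub>2 * y)\<close> turns the linear relation into
      an affine map applied to \<open>ee (\<delta> * y)\<close>; the endpoint 0 shows that it fixes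
      1.\<close>
    have affine: "\<exists>\<alpha> \<beta>. \<alpha> + \<beta> = 1 \<and> (\<forall>y\<in>endpoints. ee ((x - x\<^sub>2) * y) = \<alpha> * ee (\<delta> * y) + \<beta>)" if x': "x \<in> \<Lambda> - G" for x
    proof -
      obtain \<alpha> \<beta> where *: "\<And>y. y \<in> endpoints \<Longrightarrow> ee (x * y) = \<alpha> * ee (x\<^sub>1 * y) + \<beta> * ee (x\<^sub>2 * y)"
        using lin[OF x'] by blast
      have "\<alpha> + \<beta> = 1" using *[OF endpoints(1)] by simp
      moreover have "ee ((x - x\<^sub>2) * y) = \<alpha> * ee (\<delta> * y) + \<beta>" if "y \<in> endpoints" for y
        using *[OF that] by (simp add: \<delta>_def ee_left_diff add_divide_distrib)
      ultimately show ?thesis by blast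
    qed
    show ?thesis
    proof (cases "\<exists>y\<in>endpoints. ee (\<delta> * y) \<noteq> 1 \<and> ee (\<delta> * y) \<noteq> ee (\<delta> * y\<^sub>0)")
      case True
      then obtain y\<^sub>3 where y3: "y\<^sub>3 \<in> endpoints" "ee (\<delta> * y\<^sub>3) \<noteq> 1" "ee (\<delta> * y\<^sub>3) \<noteq> ee (\<delta> * y\<^sub>0)" by blast
      have third: "x - x\<^sub>1 \<in> G \<or> x - x\<^sub>2 \<in> G" if x': "x \<in> \<Lambda> - G" for x
      proof -
        obtain \<alpha> \<beta> where ab: "\<alpha> + \<beta> = 1" "\<And>y. y \<in> endpoints \<Longrightarrow> ee ((x - x\<^sub>2) * y) = \<alpha> * ee (\<delta> * y) + \<beta>"
          using affine[OF x'] by blast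
        have unit: "norm (\<alpha> * ee (\<delta> * y) + \<beta>) = 1" if "y \<in> endpoints" for y
          using ab(2)[OF that] by (metis norm_ee)
        \<comment> \<open>Three distinct points stay on the circle: 1, the value at the endpoint 0,
          and the values at \<open>y\<^sub>0\<close> and \<open>y\<^sub>3\<close>. The two outcomes
          put \<open>x\<close> into the coset of \<open>x\<^sub>2\<close> or of
          \<open>x\<^sub>1\<close>.\<close>
        have "\<alpha> = 0 \<or> \<beta> = 0"
          using unit[OF endpoints(1)] unit[OF y0(1)] unit[OF y3(1)] y0 y3
          by (intro affine_unit_circle[of 1 "ee (\<delta> * y\<^sub>0)" "ee (\<delta> * y\<^sub>3)"]) auto
        then show ?thesis
        proof
          assume "\<alpha> = 0"
          then show ?thesis using ab by (simp add: G_def)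
        next
          assume "\<beta> = 0"
          then have "ee ((x - x\<^sub>2) * y) = ee ((x\<^sub>1 - x\<^sub>2) * y)" if "y \<in> endpoints" for y
            using ab that by (simp add: \<delta>_def)
          then show ?thesis by (simp add: G_def ee_left_diff)
        qed
      qed
      have "x \<in> {x + z |x z. x \<in> {0, x\<^sub>1, x\<^sub>2} \<and> z \<in> G}" if x': "x \<in> \<Lambda>" for x
      proof (cases "x \<in> G")
        case False
        then have "x - x\<^sub>1 \<in> G \<or> x - x\<^sub>2 \<in> G" "x = x\<^sub>1 + (x - x\<^sub>1)" "x = x\<^sub>2 + (x - x\<^sub>2)"
          using third x' by auto
        then show ?thesis by blast
      qed force
      moreover have "{x + z |x z. x \<in> {0, x\<^sub>1, x\<^sub>2} \<and> z \<in> G} \<subseteq> \<Lambda>"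
        using G_sub add_G x by auto
      ultimately have "\<Lambda> = {x + z |x z. x \<in> {0, x\<^sub>1, x\<^sub>2} \<and> z \<in> G}" by blast
      then show ?thesis
        using x minus[of x\<^sub>1 0] minus[of x\<^sub>2 0] minus[of x\<^sub>1 x\<^sub>2]
        by (intro tilesI[of "{0, x\<^sub>1, x\<^sub>2}"]) (auto simp: card_insert_if)
    next
      case False
      define E where "E = {y\<in>endpoints. ee (\<delta> * y) = 1}"
      have E: "ee (\<delta> * y) = (if y \<in> E then 1 else ee (\<delta> * y\<^sub>0))" if "y \<in> endpoints" for y
        using False that by (auto simp: E_def)
      \<comment> \<open>Now \<open>ee (\<delta> * y)\<close> takes two values on the endpoints.
        \<open>H\<close> is the group of frequencies with the same pattern;
        \<open>\<Lambda> - G\<close> will lie in \<open>x\<^sub>2 + H\<close>, and this coset in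
        \<open>\<Lambda>\<close>.\<close>
      define H where "H = {x. (\<forall>y\<in>E. ee (x * y) = 1) \<and> (\<forall>y\<in>endpoints-E. \<forall>y'\<in>endpoints-E. ee (x * y) = ee (x * y'))}"
      have H_0: "0 \<in> H" by (simp add: H_def)
      have H_diff: "x - z \<in> H" if "x \<in> H" "z \<in> H" for x z
      proof -
        have "ee ((x - z) * y) = 1" if "y \<in> E" for y
          using that \<open>x \<in> H\<close> \<open>z \<in> H\<close> by (simp add: H_def ee_left_diff)
        moreover have "ee ((x - z) * y) = ee ((x - z) * y')" if y: "y \<in> endpoints - E" "y' \<in> endpoints - E" for y y'
        proof -
          have "ee (x * y) = ee (x * y')" "ee (z * y) = ee (z * y')"
            using \<open>x \<in> H\<close> \<open>z \<in> H\<close> y unfolding H_def by blast+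
          then show ?thesis by (simp add: ee_left_diff)
        qed
        ultimately show ?thesis unfolding H_def by blast
      qed
      have G_H: "G \<subseteq> H" by (auto simp: G_def H_def E_def)
      have E_sub: "E \<subseteq> endpoints" by (auto simp: E_def)
      have \<delta>_H: "\<delta> \<in> H" unfolding H_def using E E_sub by (simp add: subset_iff)
      have "\<exists>y. y \<noteq> 0 \<and> (\<forall>x\<in>H. x * y \<in> \<int>)"
      proof -
        have inE: "\<forall>x\<in>H. x * y \<in> \<int>" if "y \<in> E" for y
          using that by (auto simp: H_def ee_eq_1_iff)
        have notinE: "\<forall>x\<in>H. x * (y - y') \<in> \<int>" if "y \<in> endpoints - E" "y' \<in> endpoints - E" for y y'
          using that unfolding H_def ee_eq_iff right_diff_distrib by blast
        show ?thesis
          \<comment> \<open>One of the two nonzero endpoints is in \<open>E\<close>, or else their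
            difference serves.\<close>
          using inE[of y\<^sub>1] inE[of y\<^sub>2] notinE[of y\<^sub>1 y\<^sub>2] endpoints by (metis DiffI right_minus_eq)
      qed
      then obtain y where y: "y \<noteq> 0" "\<And>x. x \<in> H \<Longrightarrow> x * y \<in> \<int>" by blast
      obtain h where h: "h > 0" "H = range (\<lambda>k::int. h * of_int k)"
        using real_subgroup_cyclic[OF H_0 H_diff _ _ y, of "real d"] d_G G_H d by auto
      have \<Lambda>_H: "x - x\<^sub>2 \<in> H" if x': "x \<in> \<Lambda> - G" for x
      proof -
        obtain \<alpha> \<beta> where ab: "\<alpha> + \<beta> = 1" "\<And>y. y \<in> endpoints \<Longrightarrow> ee ((x - x\<^sub>2) * y) = \<alpha> * ee (\<delta> * y) + \<beta>"
          using affine[OF x'] by blast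
        then show ?thesis unfolding H_def using E E_sub by (simp add: subset_iff)
      qed
      have H_\<Lambda>: "x\<^sub>2 + z \<in> \<Lambda>" if z: "z \<in> H" for z
      proof -
        define w where "w = ee (\<delta> * y\<^sub>0)"
        \<comment> \<open>The slope of the affine map that fixes 1 and sends \<open>w\<close> to
          \<open>ee (z * y\<^sub>0)\<close>.\<close>
        define \<alpha> where "\<alpha> = (ee (z * y\<^sub>0) - 1) / (w - 1)"
        have w: "w \<noteq> 1" using y0 by (simp add: w_def)
        have y0E: "y\<^sub>0 \<in> endpoints - E" using y0 by (simp add: E_def)
        have ee_z: "ee (z * y) = \<alpha> * ee (\<delta> * y) + (1 - \<alpha>)" if "y \<in> endpoints" for y
        proof (cases "y \<in> E")
          case True
          then show ?thesis using z E[OF that] by (simp add: H_def)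
        next
          case False
          then have "ee (z * y) = ee (z * y\<^sub>0)" using z y0E that unfolding H_def by blast
          moreover have "\<alpha> * (w - 1) = ee (z * y\<^sub>0) - 1" using w by (simp add: \<alpha>_def)
          ultimately show ?thesis using E[OF that] False by (simp add: w_def algebra_simps)
        qed
        have "ee ((x\<^sub>2 + z) * y) = \<alpha> * ee (x\<^sub>1 * y) + (1 - \<alpha>) * ee (x\<^sub>2 * y)" if "y \<in> endpoints" for y
        proof -
          have "B \<noteq> 0 \<Longrightarrow> B * (\<alpha> * (A / B) + (1 - \<alpha>)) = \<alpha> * A + (1 - \<alpha>) * B" for A B :: complex
            by (simp add: field_simps)
          from this[OF ee_neq_0] show ?thesis
            unfolding ee_left_add ee_z[OF that] \<delta>_def ee_left_diff .
        qed
        then show ?thesis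
          using mem_lincomb[OF _ DiffD1[OF x(1)] DiffD1[OF x(2)]] by blast
      qed
      show ?thesis
      proof (cases "x\<^sub>2 \<in> H")
        case True
        have "\<Lambda> \<subseteq> H"
          using \<Lambda>_H G_H H_diff[OF _ H_diff[OF H_0 True]] by force
        moreover have "H \<subseteq> \<Lambda>"
          using H_\<Lambda> H_diff[OF _ True] by force
        ultimately show ?thesis
          by (intro tiles_if_few_cosets[OF h, of "{0}"]) auto
      next
        case False
        have "D (h * of_int k)" for k
        proof -
          have "h * of_int k \<in> H" using h by auto
          then show ?thesis using D_diff[OF H_\<Lambda>[of "h * of_int k"], of x\<^sub>2] x by simp
        qed
        then obtain n where n: "h = real n" "n > 0" using g_natural[OF h(1)] by blast
        obtain k :: int where k: "real d = h * of_int k" using d_G G_H h by auto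
        then have dk: "int d = int n * k" using n by (metis of_int_mult of_int_of_nat_eq of_int_eq_iff)
        then have "k > 0" using d n by (metis of_nat_0_less_iff zero_less_mult_pos)
        then obtain m :: nat where m: "k = int m" "m > 0" by (metis zero_less_imp_eq_int)
        then have dm: "d = n * m" using dk by (metis of_nat_eq_iff of_nat_mult)
        \<comment> \<open>\<open>\<Lambda>\<close> is \<open>G\<close> together with the disjoint
          coset \<open>x\<^sub>2 + H\<close>, and \<open>G\<close> has index \<open>m\<close> in
          \<open>H\<close>; these are \<open>m + 1\<close> representatives modulo
          \<open>d\<close>.\<close>
        define R where "R = insert 0 ((\<lambda>i. x\<^sub>2 + h * real i) ` {..<m})"
        have memH: "h * of_int i \<in> H" for i using h by auto
        have notin: "x\<^sub>2 + h * of_int i \<notin> G" for i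
        proof
          assume "x\<^sub>2 + h * of_int i \<in> G"
          then have "x\<^sub>2 + h * of_int i - h * of_int i \<in> H" using H_diff[OF _ memH[of i]] G_H by blast
          then show False using False by simp
        qed
        have in_G: "h * of_int i \<in> G \<longleftrightarrow> int m dvd i" for i
        proof
          assume "h * of_int i \<in> G"
          then obtain j :: int where "h * of_int i = real d * of_int j" using G by auto
          then have "real_of_int i = of_int (int m * j)" using n by (simp add: dm)
          then show "int m dvd i" by (simp only: of_int_eq_iff) simp
        next
          assume "int m dvd i"
          then obtain j where "i = int m * j" by auto
          then have "h * of_int i = real d * of_int j" using n by (simp add: dm)
          then show "h * of_int i \<in> G" using G(1) by auto
        qed
        have inj: "inj_on (\<lambda>i. x\<^sub>2 + h * real i) {..<m}" using h by (auto simp: inj_on_def)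
        have "0 \<notin> (\<lambda>i. x\<^sub>2 + h * real i) ` {..<m}" using notin[of "int _"] G_0 by (metis (mono_tags) imageE of_int_of_nat_eq)
        then have card_R: "card R = m + 1" using inj by (simp add: R_def card_image)
        interpret R: coset_spectrum J l u \<Lambda> "real d" R
        proof (rule coset_spectrumI[OF d_pos])
          show "finite R" by (simp add: R_def)
          have "x \<in> {x + real d * of_int k |x k. x \<in> R}" if x': "x \<in> \<Lambda>" for x
          proof (cases "x \<in> G")
            case True
            then show ?thesis using G(1) by (force simp: R_def)
          next
            case False
            then have "x - x\<^sub>2 \<in> H" using \<Lambda>_H x' by blast
            then obtain i where i: "x - x\<^sub>2 = h * of_int i" unfolding h(2) by (rule rangeE)
            define r where "r = nat (i mod int m)"
            have r: "r < m" using m(2) by (simp add: r_def nat_less_iff)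
            have "int r + int m * (i div int m) = i" using m(2) by (simp add: r_def)
            then have "real r + real m * of_int (i div int m) = of_int i"
              by (metis of_int_add of_int_mult of_int_of_nat_eq)
            then have "x = x\<^sub>2 + h * (real r + real m * of_int (i div int m))" using i by simp
            then have "x = (x\<^sub>2 + h * real r) + real d * of_int (i div int m)"
              by (simp add: dm n(1) distrib_left mult.assoc)
            then show ?thesis using r unfolding R_def by blast
          qed
          moreover have "x + real d * of_int k \<in> \<Lambda>" if "x \<in> R" for x k
          proof (rule add_G)
            have "x\<^sub>2 + h * real i \<in> \<Lambda>" for i using H_\<Lambda>[OF memH[of "int i"]] by simp
            then show "x \<in> \<Lambda>" using that zero unfolding R_def by blast
            show "real d * of_int k \<in> G" using G(1) by auto
          qed
          ultimately show "\<Lambda> = {x + real d * of_int k |x k. x \<in> R}" by blast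
          fix x z assume xz: "x \<in> R" "z \<in> R" "x \<noteq> z"
          have "x - z \<notin> G"
          proof -
            have diff: "(x\<^sub>2 + h * real i) - (x\<^sub>2 + h * real j) \<notin> G" if "i < m" "j < m" "i \<noteq> j" for i j
            proof -
              have "\<not> int m dvd int i - int j"
                using that by (simp add: mod_eq_dvd_iff[symmetric])
              then show ?thesis using in_G[of "int i - int j"] by (simp add: algebra_simps)
            qed
            have "x\<^sub>2 + h * real i - 0 \<notin> G" "0 - (x\<^sub>2 + h * real i) \<notin> G" for i
              using notin[of "int i"] minus[of "x\<^sub>2 + h * real i" 0] by auto
            then show ?thesis using xz diff unfolding R_def by blast
          qed
          then show "(x - z) / real d \<notin> \<int>"
          proof (rule contrapos_nn)
            assume "(x - z) / real d \<in> \<int>"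
            then obtain k where "(x - z) / real d = of_int k" by (auto elim: Ints_cases)
            then show "x - z \<in> G" using d_pos G(1) by (auto simp: field_simps)
          qed
        qed
        \<comment> \<open>The count of cosets reads \<open>n * m = m + 1\<close>, hence
          \<open>m = 1\<close> and \<open>H = G\<close>; but \<open>\<delta>\<close> lies in
          \<open>H\<close> and not in \<open>G\<close>.\<close>
        have "d = card R" using R.g_eq_card_R by (simp only: of_nat_eq_iff)
        then have "n * m = m + 1" using card_R dm by simp
        then have "m dvd 1" by (metis dvd_add_right_iff dvd_refl dvd_triv_right)
        then have "H \<subseteq> G" using in_G unfolding h(2) by auto
        then show ?thesis using \<delta>_H x by (auto simp: \<delta>_def)
      qed
    qed
  qed
qed

end

section \<open>The isotropic space\<close>

text \<open>For two vectors \<open>phi x\<close>, \<open>phi y\<close> this is the difference of the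
  two sides of \<open>D (x - y)\<close>, so \<open>phi\<close> maps a spectrum to a set on which the
  form vanishes.\<close>

definition form :: "(complex^3) \<times> (complex^3) \<Rightarrow> (complex^3) \<times> (complex^3) \<Rightarrow> complex" where
  "form v w = (\<Sum>i\<in>UNIV. fst v $ i * cnj (fst w $ i)) - (\<Sum>i\<in>UNIV. snd v $ i * cnj (snd w $ i))"

lemma subspace_form_left: "c33.p.subspace {v. form v w = 0}"
  unfolding c33.p.subspace_def
proof (intro conjI ballI allI)
  show "x + y \<in> {v. form v w = 0}" if "x \<in> {v. form v w = 0}" "y \<in> {v. form v w = 0}" for x y
    using that by (simp add: form_def distrib_right sum.distrib)
  show "c33.scale c x \<in> {v. form v w = 0}" if "x \<in> {v. form v w = 0}" for c x
    using that by (simp add: form_def c33.scale_def mult.assoc sum_distrib_left[symmetric])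
qed (simp add: form_def)

lemma subspace_form_right: "c33.p.subspace {w. form v w = 0}"
proof -
  have "form v w = cnj (form w v)" for w by (simp add: form_def mult.commute)
  then show ?thesis using subspace_form_left[of v] by simp
qed

text \<open>The form has signature \<open>(3, 3)\<close>: the first component is injective on an isotropic subspace.\<close>

lemma dim_isotropic_le_3:
  assumes "\<And>v w. v \<in> S \<Longrightarrow> w \<in> S \<Longrightarrow> form v w = 0"
  shows "c33.p.dim S \<le> 3"
proof -
  have "form v w = 0" if "v \<in> c33.p.span S" "w \<in> S" for v w
    using c33.p.span_minimal[OF _ subspace_form_left[of w], of S] assms that by blast
  then have iso: "form v w = 0" if "v \<in> c33.p.span S" "w \<in> c33.p.span S" for v w
    using c33.p.span_minimal[OF _ subspace_form_right[of v], of S] that by blast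
  have inj: "inj_on fst (c33.p.span S)"
  proof (rule inj_onI)
    fix v w assume vw: "v \<in> c33.p.span S" "w \<in> c33.p.span S" "fst v = fst w"
    then have "form (v - w) (v - w) = 0" by (intro iso c33.p.span_diff)
    then have "(\<Sum>i\<in>UNIV. snd (v - w) $ i * cnj (snd (v - w) $ i)) = 0"
      using vw(3) by (simp add: form_def)
    then have "complex_of_real (\<Sum>i\<in>UNIV. (norm (snd (v - w) $ i))\<^sup>2) = 0"
      by (simp only: of_real_sum complex_norm_square)
    then have "(\<Sum>i\<in>UNIV. (norm (snd (v - w) $ i))\<^sup>2) = 0"
      by (simp only: of_real_eq_0_iff)
    then have "snd v = snd w"
      by (simp add: sum_nonneg_eq_0_iff vec_eq_iff)
    then show "v = w" using vw(3) by (simp add: prod_eq_iff)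
  qed
  interpret fp: finite_dimensional_vector_space_pair_1 c33.scale c33.Basis_pair
    "(*s) :: complex \<Rightarrow> complex^3 \<Rightarrow> complex^3" ..
  have "c33.p.dim S = vec.dim (fst ` S)"
    by (rule fp.dim_image_eq[OF c33.linear_fst inj, symmetric])
  also have "\<dots> \<le> vec.dim (UNIV :: (complex^3) set)"
    by (rule vec.dim_subset) simp
  also have "\<dots> = 3"
    by (simp add: card_cart_basis)
  finally show ?thesis .
qed

section \<open>The vectors \<open>phi\<close> and their spans\<close>

lemma phi_eq: "phi r s a b x =
    (vector [ee (x * r), ee (x * (a + s)), ee (x * (b + 1 - r - s))], vector [1, ee (x * a), ee (x * b)])"
proof -
  have "exp (2 * of_real pi * \<i> * of_real t) = ee t" for t
    using exp_eq_ee[of 1 t] by simp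
  then show ?thesis unfolding phi_def Let_def by (simp only:)
qed

lemma form_phi: "form (phi r s a b x) (phi r s a b y) =
    ee ((x - y) * r) + ee ((x - y) * (a + s)) + ee ((x - y) * (b + 1 - r - s))
    - (1 + ee ((x - y) * a) + ee ((x - y) * b))"
proof -
  have "ee (x * t) * ee (- (y * t)) = ee ((x - y) * t)" for t
    by (simp add: ee_add[symmetric] left_diff_distrib)
  then show ?thesis by (simp add: form_def phi_eq sum_3 cnj_ee)
qed

lemma dim_span_phi_eq_1:
  assumes "S \<noteq> {}" "\<And>x. x \<in> S \<Longrightarrow> phi r s a b x = v"
  shows "c33.p.dim (V_space r s a b S) = 1"
proof -
  have "phi r s a b ` S = {v}" using assms by auto
  moreover have "v \<noteq> 0"
  proof -
    obtain x where "x \<in> S" using assms(1) by blast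
    then have "snd v $ 1 = 1" using assms(2)[of x] by (auto simp: phi_eq)
    then show ?thesis by auto
  qed
  ultimately show ?thesis by (simp add: V_space_def)
qed

text \<open>The first coordinate of the second component of \<open>phi\<close> is always 1, so two
  distinct vectors are not proportional. A third vector outside their span would raise the dimension
  to 3.\<close>

lemma phi_mem_span_pair:
  assumes dim: "c33.p.dim (V_space r s a b S) < 3"
    and "x\<^sub>1 \<in> S" "x\<^sub>2 \<in> S" "x \<in> S" and ne: "phi r s a b x\<^sub>1 \<noteq> phi r s a b x\<^sub>2"
  shows "\<exists>\<alpha> \<beta>. phi r s a b x = c33.scale \<alpha> (phi r s a b x\<^sub>1) + c33.scale \<beta> (phi r s a b x\<^sub>2)"
proof -
  let ?\<phi> = "phi r s a b"
  have "?\<phi> x\<^sub>1 \<notin> c33.p.span {?\<phi> x\<^sub>2}"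
  proof
    assume "?\<phi> x\<^sub>1 \<in> c33.p.span {?\<phi> x\<^sub>2}"
    then obtain k where k: "?\<phi> x\<^sub>1 = c33.scale k (?\<phi> x\<^sub>2)"
      by (auto simp: c33.p.span_singleton)
    then have "snd (?\<phi> x\<^sub>1) $ 1 = k * snd (?\<phi> x\<^sub>2) $ 1" by (simp add: c33.scale_def)
    then have "k = 1" by (simp add: phi_eq)
    then show False using k ne by simp
  qed
  moreover have "?\<phi> x\<^sub>2 \<noteq> 0"
  proof
    assume "?\<phi> x\<^sub>2 = 0"
    then have "snd (?\<phi> x\<^sub>2) $ 1 = 0" by simp
    then show False by (simp add: phi_eq)
  qed
  ultimately have indep: "c33.p.independent {?\<phi> x\<^sub>1, ?\<phi> x\<^sub>2}"
    using ne by (simp add: c33.p.independent_insert)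
  have "?\<phi> x \<in> c33.p.span {?\<phi> x\<^sub>1, ?\<phi> x\<^sub>2}"
  proof (rule ccontr)
    assume notin: "?\<phi> x \<notin> c33.p.span {?\<phi> x\<^sub>1, ?\<phi> x\<^sub>2}"
    then have new: "?\<phi> x \<notin> {?\<phi> x\<^sub>1, ?\<phi> x\<^sub>2}"
      by (rule contra_subsetD[OF c33.p.span_superset])
    have "c33.p.independent {?\<phi> x, ?\<phi> x\<^sub>1, ?\<phi> x\<^sub>2}"
      using indep notin new by (simp only: c33.p.independent_insert[of "?\<phi> x"] if_False simp_thms)
    moreover have "{?\<phi> x, ?\<phi> x\<^sub>1, ?\<phi> x\<^sub>2} \<subseteq> V_space r s a b S"
      using assms(2-4) unfolding V_space_def by (intro subset_trans[OF _ c33.p.span_superset]) simp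
    ultimately have "card {?\<phi> x, ?\<phi> x\<^sub>1, ?\<phi> x\<^sub>2} \<le> c33.p.dim (V_space r s a b S)"
      by (intro c33.p.independent_card_le_dim)
    moreover have "card {?\<phi> x, ?\<phi> x\<^sub>1, ?\<phi> x\<^sub>2} = 3" using new ne by simp
    ultimately show False using dim by simp
  qed
  then obtain \<alpha> where "?\<phi> x - c33.scale \<alpha> (?\<phi> x\<^sub>1) \<in> c33.p.span {?\<phi> x\<^sub>2}"
    by (auto simp: c33.p.span_breakdown_eq[of _ "?\<phi> x\<^sub>1"])
  then obtain \<beta> where "?\<phi> x - c33.scale \<alpha> (?\<phi> x\<^sub>1) = c33.scale \<beta> (?\<phi> x\<^sub>2)"
    by (auto simp: c33.p.span_singleton)
  then have "?\<phi> x = c33.scale \<alpha> (?\<phi> x\<^sub>1) + c33.scale \<beta> (?\<phi> x\<^sub>2)"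
    by (simp add: diff_eq_eq add.commute)
  then show ?thesis by blast
qed

section \<open>The two cases for three intervals\<close>

theorem mainTheorem1:
  fixes r s a b :: real and \<Omega> \<Lambda> :: "real set" and d :: nat
  assumes "0 < r" and "0 < s" and "r + s < 1"
    and "{0..r} \<inter> {a..a + s} = {}"
    and "{0..r} \<inter> {b..b + 1 - r - s} = {}"
    and "{a..a + s} \<inter> {b..b + 1 - r - s} = {}"
    and "\<Omega> = three_intervals r s a b"
    and "spectral_pair \<Omega> \<Lambda>"
    and "0 \<in> \<Lambda>"
    and "0 < d" and "int_multiples d \<subseteq> \<Lambda>"
    and "\<And>m. 0 < m \<Longrightarrow> int_multiples m \<subseteq> \<Lambda> \<Longrightarrow> d \<le> m"
    and "\<not> (c33.p.dim (V_space r s a b (int_multiples d)) = 1 \<and>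
            c33.p.dim (V_space r s a b (\<Lambda> - int_multiples d)) = 3)"
  shows "tiles_by_translations \<Omega>"
proof -
  define l where "l j = (if j = 0 then 0 else if j = 1 then a else b)" for j :: nat
  define u where "u j = (if j = 0 then r else if j = 1 then a + s else b + 1 - r - s)" for j :: nat
  define J where "J = {0, 1, 2 :: nat}"
  interpret iu: interval_union J l u
    by unfold_locales
      (use assms(1-6) in \<open>auto simp: J_def l_def u_def Int_commute\<close>)
  have \<Omega>: "iu.\<Omega> = \<Omega>"
    unfolding iu.\<Omega>_def assms(7) three_intervals_def by (simp add: J_def l_def u_def Un_assoc)
  interpret spectral_intervals J l u \<Lambda>
    by unfold_locales (simp add: \<Omega> assms(8))
  have D_iff: "iu.D x \<longleftrightarrow> ee (x * r) + ee (x * (a + s)) + ee (x * (b + 1 - r - s)) = 1 + ee (x * a) + ee (x * b)" for x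
    unfolding iu.D_def by (simp add: J_def l_def u_def add.assoc)
  interpret triple: spectral_triple 0 a b r "a + s" "b + 1 - r - s" "real d" \<Lambda>
  proof unfold_locales
    show "x \<in> \<Lambda>" if "\<And>y. y \<in> \<Lambda> \<Longrightarrow>
        ee ((x - y) * r) + ee ((x - y) * (a + s)) + ee ((x - y) * (b + 1 - r - s))
          = ee ((x - y) * 0) + ee ((x - y) * a) + ee ((x - y) * b)" for x
      using that by (intro maximal) (simp add: D_iff)
    show "ee ((x - y) * r) + ee ((x - y) * (a + s)) + ee ((x - y) * (b + 1 - r - s))
          = ee ((x - y) * 0) + ee ((x - y) * a) + ee ((x - y) * b)" if "x \<in> \<Lambda>" "y \<in> \<Lambda>" for x y
      using D_diff[OF that] by (simp add: D_iff)
    show "real d * of_int k \<in> \<Lambda>" for k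
      using assms(11) by (auto simp: int_multiples_def)
  qed (use assms(10) in auto)
  show ?thesis
  \<comment> \<open>As 0 is an endpoint, a single class modulo 1/d means that
    \<open>ee (d * y) = 1\<close> at all six endpoints.\<close>
  proof (cases "ee (real d * 0) = ee (real d * a) \<and> ee (real d * a) = ee (real d * b) \<and>
      ee (real d * r) = ee (real d * 0) \<and> ee (real d * (a + s)) = ee (real d * 0) \<and> ee (real d * (b + 1 - r - s)) = ee (real d * 0)")
    case False
    obtain g R where gR: "g > 0" "finite R" "card R \<le> 3"
      "\<Lambda> = {x + h |x h. x \<in> R \<and> h \<in> range (\<lambda>k::int. g * of_int k)}"
      "\<And>x y. x \<in> R \<Longrightarrow> y \<in> R \<Longrightarrow> x \<noteq> y \<Longrightarrow> x - y \<notin> range (\<lambda>k::int. g * of_int k)"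
      using triple.few_cosets_if_not_all_ones[OF False] unfolding few_cosets_def by blast
    show ?thesis
      using tiles_if_few_cosets[OF gR(1) refl gR(2-5)] by (simp add: \<Omega>)
  next
    case True
    have endpoints_eq: "endpoints = {0, a, b, r, a + s, b + 1 - r - s}"
      unfolding endpoints_def by (auto simp: J_def l_def u_def)
    have ones: "ee (real d * y) = 1" if "y \<in> endpoints" for y
      using True that by (auto simp: endpoints_eq)
    have ones_int: "ee (real d * of_int k * y) = 1" if "y \<in> endpoints" for y and k :: int
    proof -
      have "real d * y \<in> \<int>" using ones[OF that] by (simp add: ee_eq_1_iff)
      from Ints_mult[OF this Ints_of_int[of k]]
      show ?thesis by (simp add: ee_eq_1_iff mult_ac)
    qed
    have "phi r s a b x = phi r s a b 0" if "x \<in> int_multiples d" for x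
      using that ones_int by (auto simp: int_multiples_def phi_eq endpoints_eq)
    moreover have "int_multiples d \<noteq> {}" by (auto simp: int_multiples_def)
    ultimately have "c33.p.dim (V_space r s a b (int_multiples d)) = 1"
      using dim_span_phi_eq_1 by blast
    \<comment> \<open>In the single-class case the first half of the excluded conjunction holds, so
      the second fails; the bound for isotropic sets then leaves dimension at most 2.\<close>
    then have "c33.p.dim (V_space r s a b (\<Lambda> - int_multiples d)) \<noteq> 3"
      using assms(13) by blast
    moreover have "c33.p.dim (V_space r s a b (\<Lambda> - int_multiples d)) \<le> 3"
    proof -
      have "form v w = 0" if vw: "v \<in> phi r s a b ` \<Lambda>" "w \<in> phi r s a b ` \<Lambda>" for v w
      proof -
        obtain x y where "v = phi r s a b x" "w = phi r s a b y" "x \<in> \<Lambda>" "y \<in> \<Lambda>" using vw by blast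
        then show ?thesis using D_diff[of x y] by (simp add: form_phi D_iff)
      qed
      then have "c33.p.dim (phi r s a b ` (\<Lambda> - int_multiples d)) \<le> 3"
        by (intro dim_isotropic_le_3) blast
      then show ?thesis by (simp add: V_space_def)
    qed
    ultimately have dim: "c33.p.dim (V_space r s a b (\<Lambda> - int_multiples d)) < 3" by linarith
    have "tiles_by_translations iu.\<Omega>"
    proof (rule tiles_if_endpoints_in_lattice[of r a d])
      show "0 \<in> endpoints" "r \<in> endpoints" "a \<in> endpoints" "r \<noteq> 0" "a \<noteq> 0" "r \<noteq> a"
        using assms(1,2,4) by (auto simp: endpoints_eq)
      show "0 \<in> \<Lambda>" "d > 0" by (fact assms)+
      show "ee (real d * y) = 1" if "y \<in> endpoints" for y by (rule ones[OF that])
      show "d \<le> m" if "m > 0" "int_multiples m \<subseteq> \<Lambda>" for m by (rule assms(12)[OF that])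
      fix x\<^sub>1 x\<^sub>2 x y
      assume x: "x\<^sub>1 \<in> \<Lambda> - int_multiples d" "x\<^sub>2 \<in> \<Lambda> - int_multiples d" "x \<in> \<Lambda> - int_multiples d"
        and y: "y \<in> endpoints" "ee (x\<^sub>1 * y) \<noteq> ee (x\<^sub>2 * y)"
      have "phi r s a b x\<^sub>1 \<noteq> phi r s a b x\<^sub>2"
      proof
        assume eq: "phi r s a b x\<^sub>1 = phi r s a b x\<^sub>2"
        from arg_cong[OF eq, of "\<lambda>v. fst v $ 1"] arg_cong[OF eq, of "\<lambda>v. fst v $ 2"]
          arg_cong[OF eq, of "\<lambda>v. fst v $ 3"] arg_cong[OF eq, of "\<lambda>v. snd v $ 2"]
          arg_cong[OF eq, of "\<lambda>v. snd v $ 3"]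
        have "\<forall>y\<in>endpoints. ee (x\<^sub>1 * y) = ee (x\<^sub>2 * y)" by (simp add: phi_eq endpoints_eq)
        then show False using y by blast
      qed
      then obtain \<alpha> \<beta> where eq: "phi r s a b x = c33.scale \<alpha> (phi r s a b x\<^sub>1) + c33.scale \<beta> (phi r s a b x\<^sub>2)"
        using phi_mem_span_pair[OF dim x] by blast
      \<comment> \<open>The six coordinates of \<open>phi\<close> are the values at the six
        endpoints; the constant coordinate belongs to the endpoint 0.\<close>
      from arg_cong[OF eq, of "\<lambda>v. fst v $ 1"] arg_cong[OF eq, of "\<lambda>v. fst v $ 2"]
        arg_cong[OF eq, of "\<lambda>v. fst v $ 3"] arg_cong[OF eq, of "\<lambda>v. snd v $ 1"]
        arg_cong[OF eq, of "\<lambda>v. snd v $ 2"] arg_cong[OF eq, of "\<lambda>v. snd v $ 3"]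
      have "\<forall>y\<in>endpoints. ee (x * y) = \<alpha> * ee (x\<^sub>1 * y) + \<beta> * ee (x\<^sub>2 * y)"
        by (simp add: phi_eq endpoints_eq c33.scale_def)
      then show "\<exists>\<alpha> \<beta>. \<forall>y\<in>endpoints. ee (x * y) = \<alpha> * ee (x\<^sub>1 * y) + \<beta> * ee (x\<^sub>2 * y)" by blast
    qed
    then show ?thesis by (simp add: \<Omega>)
  qed
qed

end
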